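(* Let $\mathcal{H}$ be a complex Hilbert space and let $X\in\mathfrak{B}(\mathcal{H})$ satisfy $(X^*X)X=X$. Then there exist Hilbert spaces $\mathcal{H}_1,\mathcal{H}_2,\mathcal{H}_3$ (possibly zero), a positive operator $A\in\mathfrak{B}(\mathcal{H}_1)$ whose support is $I_{\mathcal{H}_1}$, a unitary $U\in\mathfrak{B}(\mathcal{H}_2)$, and an isomorphism $\mathcal{H}\cong\mathcal{H}_1^\infty\oplus\mathcal{H}_2\oplus\mathcal{H}_3$ of Hilbert spaces under which $X$ is unitarily equivalent to $S_A\oplus U\oplus 0$. This decomposition is unique up to unitary equivalence: if $(\mathcal{H}_1',\mathcal{H}_2',\mathcal{H}_3',A',U')$ is another such collection of data for $X$, then there are unitaries $W_i\colon\mathcal{H}_i\to\mathcal{H}_i'$ ($i=1,2,3$) with $W_1AW_1^*=A'$ and $W_2UW_2^*=U'$. Moreover, $X$ is a scaling element (i.e. $X^*X\neq XX^*$) if and only if $\mathcal{H}_1\neq 0$.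
   Context: $\mathfrak{B}(\mathcal{H})$ is the $C^*$-algebra of all bounded operators on $\mathcal{H}$ and $I_{\mathcal{H}}$ its identity. $\mathbb{N}=\{0,1,2,\dots\}$. For a Hilbert space $\mathcal{H}$, $\mathcal{H}^\infty=\{(\xi_n)_{n\in\mathbb{N}} : \xi_n\in\mathcal{H},\ \sum_{n}\|\xi_n\|^2<\infty\}$ is the Hilbert space direct sum of countably many copies of $\mathcal{H}$. For $A\in\mathfrak{B}(\mathcal{H})$, the operator $S_A\in\mathfrak{B}(\mathcal{H}^\infty)$ is defined by $S_A(\xi_0,\xi_1,\xi_2,\dots)=(0,A\xi_0,\xi_1,\xi_2,\dots)$. The support of a positive operator $A$ is the smallest projection $P$ with $PA=A$ (equivalently $AP=A$); so the support being the identity means that $A$ is injective (equivalently, has dense range). A scaling element is an element $X$ of a $C^*$-algebra with $(X^*X)X=X$ and $X^*X\neq XX^*$. *)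

theory Defs
  imports "HOL-Analysis.Analysis"
begin

section \<open>Complex Hilbert spaces\<close>

class complex_vector = real_vector +
  fixes scaleC :: "complex \<Rightarrow> 'a \<Rightarrow> 'a" (infixr "*\<^sub>C" 75)
  assumes scaleC_add_right: "a *\<^sub>C (x + y) = a *\<^sub>C x + a *\<^sub>C y"
    and scaleC_add_left: "(a + b) *\<^sub>C x = a *\<^sub>C x + b *\<^sub>C x"
    and scaleC_scaleC: "a *\<^sub>C b *\<^sub>C x = (a * b) *\<^sub>C x"
    and scaleR_scaleC: "r *\<^sub>R x = complex_of_real r *\<^sub>C x"

text \<open>The complex inner product is linear in its first argument.  Its real part is the inner
  product of the class \<^class>\<open>real_inner\<close>, so norm and topology are those of the library, and
  positive definiteness of \<open>cinner\<close> is inherited.\<close>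

class complex_inner = complex_vector + real_inner +
  fixes cinner :: "'a \<Rightarrow> 'a \<Rightarrow> complex"
  assumes cinner_commute: "cinner x y = cnj (cinner y x)"
    and cinner_add_left: "cinner (x + y) z = cinner x z + cinner y z"
    and cinner_scaleC_left: "cinner (a *\<^sub>C x) y = a * cinner x y"
    and inner_cinner: "inner x y = Re (cinner x y)"

class chilbert_space = complex_inner + complete_space

lemma scaleC_one [simp]: "1 *\<^sub>C (x::'a::complex_vector) = x"
  by (metis of_real_1 scaleR_one scaleR_scaleC)

lemma scaleC_zero_left [simp]: "0 *\<^sub>C (x::'a::complex_vector) = 0"
  by (metis of_real_0 scaleR_zero_left scaleR_scaleC)

lemma cinner_self: "cinner (x::'a::complex_inner) x = complex_of_real ((norm x)\<^sup>2)"
proof -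
  have "Im (cinner x x) = 0"
    by (metis cinner_commute cnj.simps(2) equal_neg_zero)
  then show ?thesis
    by (simp add: complex_eq_iff dot_square_norm flip: inner_cinner)
qed

lemma cinner_add_right: "cinner (x::'a::complex_inner) (y + z) = cinner x y + cinner x z"
  by (metis cinner_add_left cinner_commute complex_cnj_add)

lemma cinner_scaleC_right: "cinner (x::'a::complex_inner) (a *\<^sub>C y) = cnj a * cinner x y"
  by (metis cinner_commute cinner_scaleC_left complex_cnj_mult)

lemma cinner_inner:
  "cinner (x::'a::complex_inner) y = Complex (inner x y) (inner x (\<i> *\<^sub>C y))"
  by (simp add: complex_eq_iff inner_cinner cinner_scaleC_right)

lemma norm_scaleC: "norm (a *\<^sub>C (x::'a::complex_inner)) = cmod a * norm x"
proof -
  have "complex_of_real ((norm (a *\<^sub>C x))\<^sup>2) = (a * cnj a) * cinner x x"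
    by (simp only: cinner_self [symmetric] cinner_scaleC_left cinner_scaleC_right mult.assoc
        mult.left_commute)
  also have "\<dots> = complex_of_real ((cmod a * norm x)\<^sup>2)"
    by (simp only: cinner_self complex_norm_square [symmetric] power_mult_distrib of_real_mult)
  finally have "(norm (a *\<^sub>C x))\<^sup>2 = (cmod a * norm x)\<^sup>2"
    by (simp only: of_real_eq_iff)
  then show ?thesis
    by (simp add: power2_eq_iff_nonneg)
qed

lemma norm_cinner_le: "cmod (cinner (x::'a::complex_inner) y) \<le> 2 * (norm x * norm y)"
proof -
  have "cmod (cinner x y) \<le> \<bar>inner x y\<bar> + \<bar>inner x (\<i> *\<^sub>C y)\<bar>"
    using cmod_le [of "cinner x y"] by (simp add: cinner_inner)
  also have "\<dots> \<le> norm x * norm y + norm x * norm (\<i> *\<^sub>C y)"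
    by (intro add_mono Cauchy_Schwarz_ineq2)
  finally show ?thesis by (simp add: norm_scaleC)
qed

instantiation complex :: complex_inner
begin

definition scaleC_complex :: "complex \<Rightarrow> complex \<Rightarrow> complex"
  where "scaleC_complex a x = a * x"
definition cinner_complex :: "complex \<Rightarrow> complex \<Rightarrow> complex"
  where "cinner_complex x y = x * cnj y"

instance
  by standard
    (simp_all add: scaleC_complex_def cinner_complex_def inner_complex_def scaleR_conv_of_real
      algebra_simps)

end

instance complex :: chilbert_space ..

instantiation prod :: (complex_vector, complex_vector) complex_vector
begin

definition "scaleC a x = (a *\<^sub>C fst x, a *\<^sub>C snd x)"

instance
  by standard
    (auto simp: scaleC_prod_def scaleC_add_right scaleC_add_left scaleC_scaleC
      scaleR_prod_def scaleR_scaleC)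

end

instantiation prod :: (complex_inner, complex_inner) complex_inner
begin

definition "cinner x y = cinner (fst x) (fst y) + cinner (snd x) (snd y)"

instance
proof
  fix x y z :: "'a \<times> 'b" and a :: complex
  show "cinner x y = cnj (cinner y x)"
    by (simp add: cinner_prod_def flip: cinner_commute)
  show "cinner (x + y) z = cinner x z + cinner y z"
    by (simp add: cinner_prod_def cinner_add_left)
  show "cinner (a *\<^sub>C x) y = a * cinner x y"
    by (simp add: cinner_prod_def scaleC_prod_def cinner_scaleC_left distrib_left)
  show "inner x y = Re (cinner x y)"
    by (simp add: cinner_prod_def inner_prod_def inner_cinner)
qed

end

instance prod :: (chilbert_space, chilbert_space) chilbert_space ..


section \<open>Square-summable sequences\<close>

typedef (overloaded) ('a::real_normed_vector) l2seq =
  "{\<xi> :: nat \<Rightarrow> 'a. summable (\<lambda>n. (norm (\<xi> n))\<^sup>2)}"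
  morphisms l2_nth Abs_l2seq
  by (rule exI [of _ "\<lambda>_. 0"]) simp

setup_lifting type_definition_l2seq

lemma l2_summable: "summable (\<lambda>n. (norm (l2_nth \<xi> n))\<^sup>2)"
  using l2_nth [of \<xi>] by simp

lemma l2_eqI: "(\<And>n. l2_nth \<xi> n = l2_nth \<eta> n) \<Longrightarrow> \<xi> = \<eta>"
  by (simp add: l2_nth_inject [symmetric] fun_eq_iff)

lemma l2_summable_add:
  fixes f g :: "nat \<Rightarrow> 'a::real_normed_vector"
  assumes "summable (\<lambda>n. (norm (f n))\<^sup>2)" "summable (\<lambda>n. (norm (g n))\<^sup>2)"
  shows "summable (\<lambda>n. (norm (f n + g n))\<^sup>2)"
proof (rule summable_comparison_test)
  show "summable (\<lambda>n. 2 * (norm (f n))\<^sup>2 + 2 * (norm (g n))\<^sup>2)"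
    using assms by (intro summable_add summable_mult)
  have "(norm (f n + g n))\<^sup>2 \<le> 2 * (norm (f n))\<^sup>2 + 2 * (norm (g n))\<^sup>2" for n
  proof -
    have "(norm (f n + g n))\<^sup>2 \<le> (norm (f n) + norm (g n))\<^sup>2"
      by (simp add: norm_triangle_ineq power_mono)
    also have "\<dots> \<le> 2 * (norm (f n))\<^sup>2 + 2 * (norm (g n))\<^sup>2"
      using sum_squares_bound [of "norm (f n)" "norm (g n)"] by (simp add: power2_sum)
    finally show ?thesis .
  qed
  then show "\<exists>N. \<forall>n\<ge>N. norm ((norm (f n + g n))\<^sup>2) \<le> 2 * (norm (f n))\<^sup>2 + 2 * (norm (g n))\<^sup>2"
    by simp
qed

lemma l2_summable_mult: "summable (\<lambda>n. norm (l2_nth \<xi> n) * norm (l2_nth \<eta> n))"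
proof (rule summable_comparison_test)
  show "summable (\<lambda>n. (norm (l2_nth \<xi> n))\<^sup>2 + (norm (l2_nth \<eta> n))\<^sup>2)"
    by (intro summable_add l2_summable)
  have "norm (l2_nth \<xi> n) * norm (l2_nth \<eta> n) \<le> (norm (l2_nth \<xi> n))\<^sup>2 + (norm (l2_nth \<eta> n))\<^sup>2" for n
    using sum_squares_bound [of "norm (l2_nth \<xi> n)" "norm (l2_nth \<eta> n)"]
      mult_nonneg_nonneg [OF norm_ge_zero [of "l2_nth \<xi> n"] norm_ge_zero [of "l2_nth \<eta> n"]]
    by linarith
  then show "\<exists>N. \<forall>n\<ge>N. norm (norm (l2_nth \<xi> n) * norm (l2_nth \<eta> n))
      \<le> (norm (l2_nth \<xi> n))\<^sup>2 + (norm (l2_nth \<eta> n))\<^sup>2"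
    by simp
qed

lemma l2_summable_inner: "summable (\<lambda>n. inner (l2_nth \<xi> n) (l2_nth \<eta> n))"
  by (rule summable_comparison_test' [OF l2_summable_mult [of \<xi> \<eta>], of 0])
    (simp add: Cauchy_Schwarz_ineq2)

lemma l2_summable_cinner: "summable (\<lambda>n. cinner (l2_nth \<xi> n) (l2_nth \<eta> n))"
  by (rule summable_comparison_test' [OF summable_mult [OF l2_summable_mult [of \<xi> \<eta>], of 2], of 0])
    (simp add: norm_cinner_le)

instantiation l2seq :: (real_normed_vector) real_vector
begin

lift_definition zero_l2seq :: "'a l2seq" is "\<lambda>_. 0" by simp
lift_definition plus_l2seq :: "'a l2seq \<Rightarrow> 'a l2seq \<Rightarrow> 'a l2seq" is "\<lambda>\<xi> \<eta> n. \<xi> n + \<eta> n"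
  by (rule l2_summable_add)
lift_definition uminus_l2seq :: "'a l2seq \<Rightarrow> 'a l2seq" is "\<lambda>\<xi> n. - \<xi> n" by simp
lift_definition minus_l2seq :: "'a l2seq \<Rightarrow> 'a l2seq \<Rightarrow> 'a l2seq" is "\<lambda>\<xi> \<eta> n. \<xi> n - \<eta> n"
proof -
  fix \<xi> \<eta> :: "nat \<Rightarrow> 'a"
  assume "summable (\<lambda>n. (norm (\<xi> n))\<^sup>2)" "summable (\<lambda>n. (norm (\<eta> n))\<^sup>2)"
  then show "summable (\<lambda>n. (norm (\<xi> n - \<eta> n))\<^sup>2)"
    using l2_summable_add [of \<xi> "\<lambda>n. - \<eta> n"] by simp
qed
lift_definition scaleR_l2seq :: "real \<Rightarrow> 'a l2seq \<Rightarrow> 'a l2seq" is "\<lambda>r \<xi> n. r *\<^sub>R \<xi> n"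
  by (simp add: power_mult_distrib summable_mult)

instance
  by standard (transfer; simp add: algebra_simps)+

end

instantiation l2seq :: (real_inner) real_inner
begin

definition inner_l2seq :: "'a l2seq \<Rightarrow> 'a l2seq \<Rightarrow> real"
  where "inner_l2seq \<xi> \<eta> = (\<Sum>n. inner (l2_nth \<xi> n) (l2_nth \<eta> n))"
definition norm_l2seq :: "'a l2seq \<Rightarrow> real"
  where "norm_l2seq \<xi> = sqrt (inner \<xi> \<xi>)"
definition sgn_l2seq :: "'a l2seq \<Rightarrow> 'a l2seq"
  where "sgn_l2seq \<xi> = \<xi> /\<^sub>R norm \<xi>"
definition dist_l2seq :: "'a l2seq \<Rightarrow> 'a l2seq \<Rightarrow> real"
  where "dist_l2seq \<xi> \<eta> = norm (\<xi> - \<eta>)"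
definition uniformity_l2seq :: "('a l2seq \<times> 'a l2seq) filter"
  where "uniformity_l2seq = (INF e\<in>{0<..}. principal {(x, y). dist x y < e})"
definition open_l2seq :: "'a l2seq set \<Rightarrow> bool"
  where "open_l2seq U = (\<forall>x\<in>U. eventually (\<lambda>(x', y). x' = x \<longrightarrow> y \<in> U) uniformity)"

instance
proof
  fix x y z :: "'a l2seq" and r :: real and U :: "'a l2seq set"
  show "dist x y = norm (x - y)" by (rule dist_l2seq_def)
  show "sgn x = x /\<^sub>R norm x" by (rule sgn_l2seq_def)
  show "uniformity = (INF e\<in>{0<..}. principal {(x, y :: 'a l2seq). dist x y < e})"
    by (rule uniformity_l2seq_def)
  show "open U = (\<forall>x\<in>U. \<forall>\<^sub>F (x', y) in uniformity. x' = x \<longrightarrow> y \<in> U)"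
    by (rule open_l2seq_def)
  show "inner x y = inner y x"
    by (simp add: inner_l2seq_def inner_commute)
  show "inner (x + y) z = inner x z + inner y z"
    by (simp add: inner_l2seq_def plus_l2seq.rep_eq inner_add_left suminf_add l2_summable_inner)
  show "inner (r *\<^sub>R x) y = r * inner x y"
    by (simp add: inner_l2seq_def scaleR_l2seq.rep_eq suminf_mult l2_summable_inner)
  show "0 \<le> inner x x"
    by (simp add: inner_l2seq_def suminf_nonneg l2_summable_inner)
  show "inner x x = 0 \<longleftrightarrow> x = 0"
  proof
    assume "inner x x = 0"
    then have "\<forall>n. inner (l2_nth x n) (l2_nth x n) = 0"
      using suminf_eq_zero_iff [OF l2_summable_inner [of x x]] by (simp add: inner_l2seq_def)
    then show "x = 0" by (intro l2_eqI) (simp add: zero_l2seq.rep_eq)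
  qed (simp add: inner_l2seq_def zero_l2seq.rep_eq)
  show "norm x = sqrt (inner x x)" by (rule norm_l2seq_def)
qed

end

instantiation l2seq :: (complex_inner) complex_inner
begin

lift_definition scaleC_l2seq :: "complex \<Rightarrow> 'a l2seq \<Rightarrow> 'a l2seq" is "\<lambda>c \<xi> n. c *\<^sub>C \<xi> n"
  by (simp add: norm_scaleC power_mult_distrib summable_mult)
definition cinner_l2seq :: "'a l2seq \<Rightarrow> 'a l2seq \<Rightarrow> complex"
  where "cinner_l2seq \<xi> \<eta> = (\<Sum>n. cinner (l2_nth \<xi> n) (l2_nth \<eta> n))"

instance
proof
  fix x y z :: "'a l2seq" and a b :: complex and r :: real
  show "a *\<^sub>C (x + y) = a *\<^sub>C x + a *\<^sub>C y" by transfer (simp add: scaleC_add_right)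
  show "(a + b) *\<^sub>C x = a *\<^sub>C x + b *\<^sub>C x" by transfer (simp add: scaleC_add_left)
  show "a *\<^sub>C b *\<^sub>C x = (a * b) *\<^sub>C x" by transfer (simp add: scaleC_scaleC)
  show "r *\<^sub>R x = complex_of_real r *\<^sub>C x" by transfer (simp add: scaleR_scaleC)
  have "(\<lambda>n. cnj (cinner (l2_nth y n) (l2_nth x n))) sums cnj (cinner y x)"
    unfolding cinner_l2seq_def sums_cnj by (rule summable_sums [OF l2_summable_cinner])
  moreover have "cnj (cinner (l2_nth y n) (l2_nth x n)) = cinner (l2_nth x n) (l2_nth y n)" for n
    by (rule cinner_commute [symmetric])
  ultimately show "cinner x y = cnj (cinner y x)"
    by (simp only: cinner_l2seq_def sums_iff)
  show "cinner (x + y) z = cinner x z + cinner y z"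
    unfolding cinner_l2seq_def plus_l2seq.rep_eq cinner_add_left
    by (rule suminf_add [symmetric]; rule l2_summable_cinner)
  show "cinner (a *\<^sub>C x) y = a * cinner x y"
    unfolding cinner_l2seq_def scaleC_l2seq.rep_eq cinner_scaleC_left
    by (rule suminf_mult [OF l2_summable_cinner])
  show "inner x y = Re (cinner x y)"
    unfolding cinner_l2seq_def inner_l2seq_def Re_suminf [OF l2_summable_cinner] inner_cinner ..
qed

end

lemma norm_l2seq_sq: "(norm \<xi>)\<^sup>2 = (\<Sum>n. (norm (l2_nth \<xi> n))\<^sup>2)"
  for \<xi> :: "'a::real_inner l2seq"
  unfolding power2_norm_eq_inner inner_l2seq_def by simp

lemma norm_l2_sum_le: "(\<Sum>n<k. (norm (l2_nth \<xi> n))\<^sup>2) \<le> (norm \<xi>)\<^sup>2"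
  for \<xi> :: "'a::real_inner l2seq"
  unfolding norm_l2seq_sq by (intro sum_le_suminf l2_summable) auto

lemma norm_l2_nth_le: "norm (l2_nth \<xi> n) \<le> norm \<xi>"
  for \<xi> :: "'a::real_inner l2seq"
proof (rule power2_le_imp_le)
  have "(norm (l2_nth \<xi> n))\<^sup>2 \<le> (\<Sum>n<Suc n. (norm (l2_nth \<xi> n))\<^sup>2)"
    by (simp add: sum_nonneg)
  then show "(norm (l2_nth \<xi> n))\<^sup>2 \<le> (norm \<xi>)\<^sup>2"
    using norm_l2_sum_le [where \<xi> = \<xi> and k = "Suc n"] by linarith
qed simp

instance l2seq :: ("{real_inner, complete_space}") complete_space
proof
  fix X :: "nat \<Rightarrow> 'a l2seq"
  assume X: "Cauchy X"
  have "Cauchy (\<lambda>n. l2_nth (X n) k)" for k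
  proof (rule CauchyI)
    fix e :: real assume "e > 0"
    then obtain M where M: "\<forall>m\<ge>M. \<forall>n\<ge>M. norm (X m - X n) < e"
      using CauchyD [OF X] by blast
    have "norm (l2_nth (X m) k - l2_nth (X n) k) \<le> norm (X m - X n)" for m n
      using norm_l2_nth_le [of "X m - X n" k] by (simp add: minus_l2seq.rep_eq)
    with M show "\<exists>M. \<forall>m\<ge>M. \<forall>n\<ge>M. norm (l2_nth (X m) k - l2_nth (X n) k) < e"
      by (meson order_le_less_trans)
  qed
  then have "\<forall>k. \<exists>l. (\<lambda>n. l2_nth (X n) k) \<longlonglongrightarrow> l"
    by (simp add: Cauchy_convergent_iff convergent_def)
  then obtain L where L: "\<And>k. (\<lambda>n. l2_nth (X n) k) \<longlonglongrightarrow> L k"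
    by metis
  have part: "(\<Sum>k<K. (norm (L k - l2_nth (X n) k))\<^sup>2) \<le> e\<^sup>2"
    if "\<forall>m\<ge>M. \<forall>n\<ge>M. norm (X m - X n) < e" "n \<ge> M" for e M n K
  proof (rule LIMSEQ_le_const2)
    show "(\<lambda>m. \<Sum>k<K. (norm (l2_nth (X m) k - l2_nth (X n) k))\<^sup>2)
        \<longlonglongrightarrow> (\<Sum>k<K. (norm (L k - l2_nth (X n) k))\<^sup>2)"
      by (intro tendsto_intros L)
    have "(\<Sum>k<K. (norm (l2_nth (X m) k - l2_nth (X n) k))\<^sup>2) \<le> e\<^sup>2" if "m \<ge> M" for m
    proof -
      have "(\<Sum>k<K. (norm (l2_nth (X m) k - l2_nth (X n) k))\<^sup>2) \<le> (norm (X m - X n))\<^sup>2"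
        using norm_l2_sum_le [where \<xi> = "X m - X n" and k = K] by (simp add: minus_l2seq.rep_eq)
      also have "\<dots> \<le> e\<^sup>2"
        using \<open>\<forall>m\<ge>M. \<forall>n\<ge>M. norm (X m - X n) < e\<close> \<open>m \<ge> M\<close> \<open>n \<ge> M\<close>
        by (intro power_mono) (auto intro: less_imp_le)
      finally show ?thesis .
    qed
    then show "\<exists>N. \<forall>m\<ge>N. (\<Sum>k<K. (norm (l2_nth (X m) k - l2_nth (X n) k))\<^sup>2) \<le> e\<^sup>2"
      by blast
  qed
  have tail: "summable (\<lambda>k. (norm (L k - l2_nth (X n) k))\<^sup>2)"
       "(\<Sum>k. (norm (L k - l2_nth (X n) k))\<^sup>2) \<le> e\<^sup>2"
    if "\<forall>m\<ge>M. \<forall>n\<ge>M. norm (X m - X n) < e" "n \<ge> M" for e M n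
  proof -
    show s: "summable (\<lambda>k. (norm (L k - l2_nth (X n) k))\<^sup>2)"
      by (rule bounded_imp_summable [where B = "e\<^sup>2"])
        (use part [OF that, where K = "Suc _"] in \<open>auto simp: lessThan_Suc_atMost\<close>)
    show "(\<Sum>k. (norm (L k - l2_nth (X n) k))\<^sup>2) \<le> e\<^sup>2"
      using s part [OF that] by (rule suminf_le_const)
  qed
  obtain M1 where M1: "\<forall>m\<ge>M1. \<forall>n\<ge>M1. norm (X m - X n) < 1"
    using CauchyD [OF X, of 1] by auto
  have "summable (\<lambda>k. (norm (L k))\<^sup>2)"
    using l2_summable_add [OF tail(1) [OF M1 order_refl] l2_summable [of "X M1"]] by simp
  then have nth: "l2_nth (Abs_l2seq L) = L"
    by (simp add: Abs_l2seq_inverse)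
  have "X \<longlonglongrightarrow> Abs_l2seq L"
  proof (rule LIMSEQ_I)
    fix r :: real assume "r > 0"
    then obtain M where M: "\<forall>m\<ge>M. \<forall>n\<ge>M. norm (X m - X n) < r / 2"
      using CauchyD [OF X, of "r / 2"] by auto
    have "norm (X n - Abs_l2seq L) < r" if "n \<ge> M" for n
    proof -
      have "(norm (Abs_l2seq L - X n))\<^sup>2 \<le> (r / 2)\<^sup>2"
        unfolding norm_l2seq_sq minus_l2seq.rep_eq nth by (rule tail(2) [OF M that])
      then have "norm (Abs_l2seq L - X n) \<le> r / 2"
        using \<open>r > 0\<close> by (auto dest: power2_le_imp_le)
      then show ?thesis using \<open>r > 0\<close> by (simp add: norm_minus_commute)
    qed
    then show "\<exists>no. \<forall>n\<ge>no. norm (X n - Abs_l2seq L) < r" by blast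
  qed
  then show "convergent X" by (rule convergentI)
qed

instance l2seq :: (chilbert_space) chilbert_space ..


section \<open>Hilbert spaces as closed subspaces, and bounded operators between them\<close>

text \<open>Since types cannot be quantified existentially, a Hilbert space is a closed complex subspace of
  a type of class \<^class>\<open>chilbert_space\<close>, possibly \<open>{0}\<close> or all of the type.  An operator between
  two such spaces is a function on the ambient types of which only the values on the domain matter;
  accordingly, equations between operators are pointwise on the domain.\<close>

definition csubspace :: "'a::complex_vector set \<Rightarrow> bool"
  where "csubspace H \<longleftrightarrow> 0 \<in> H \<and> (\<forall>x\<in>H. \<forall>y\<in>H. x + y \<in> H) \<and> (\<forall>c. \<forall>x\<in>H. c *\<^sub>C x \<in> H)"

definition hilbert_space :: "'a::chilbert_space set \<Rightarrow> bool"
  where "hilbert_space H \<longleftrightarrow> csubspace H \<and> closed H"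

definition bounded_op :: "'a::chilbert_space set \<Rightarrow> 'b::chilbert_space set \<Rightarrow> ('a \<Rightarrow> 'b) \<Rightarrow> bool"
  where "bounded_op H K T \<longleftrightarrow>
    (\<forall>x\<in>H. T x \<in> K) \<and>
    (\<forall>x\<in>H. \<forall>y\<in>H. T (x + y) = T x + T y) \<and>
    (\<forall>c. \<forall>x\<in>H. T (c *\<^sub>C x) = c *\<^sub>C T x) \<and>
    (\<exists>B. \<forall>x\<in>H. norm (T x) \<le> B * norm x)"

text \<open>The adjoint of an operator with domain \<open>H\<close>; see \<open>adj_unique_exists\<close> below.\<close>

definition adj :: "'a::chilbert_space set \<Rightarrow> ('a \<Rightarrow> 'b::chilbert_space) \<Rightarrow> 'b \<Rightarrow> 'a"
  where "adj H T y = (THE x. x \<in> H \<and> (\<forall>z\<in>H. cinner (T z) y = cinner z x))"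

definition unitary_op :: "'a::chilbert_space set \<Rightarrow> 'b::chilbert_space set \<Rightarrow> ('a \<Rightarrow> 'b) \<Rightarrow> bool"
  where "unitary_op H K W \<longleftrightarrow>
    bounded_op H K W \<and> W ` H = K \<and> (\<forall>x\<in>H. \<forall>y\<in>H. cinner (W x) (W y) = cinner x y)"

definition positive_op :: "'a::chilbert_space set \<Rightarrow> ('a \<Rightarrow> 'a) \<Rightarrow> bool"
  where "positive_op H A \<longleftrightarrow> bounded_op H H A \<and> (\<forall>x\<in>H. cinner (A x) x \<in> \<real>\<^sub>\<ge>\<^sub>0)"

definition projection_op :: "'a::chilbert_space set \<Rightarrow> ('a \<Rightarrow> 'a) \<Rightarrow> bool"
  where "projection_op H P \<longleftrightarrow>
    bounded_op H H P \<and> (\<forall>x\<in>H. P (P x) = P x) \<and> (\<forall>x\<in>H. adj H P x = P x)"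

definition is_support :: "'a::chilbert_space set \<Rightarrow> ('a \<Rightarrow> 'a) \<Rightarrow> ('a \<Rightarrow> 'a) \<Rightarrow> bool"
  where "is_support H A P \<longleftrightarrow>
    projection_op H P \<and> (\<forall>x\<in>H. P (A x) = A x) \<and>
    (\<forall>Q. projection_op H Q \<and> (\<forall>x\<in>H. Q (A x) = A x) \<longrightarrow> positive_op H (\<lambda>x. Q x - P x))"

definition scaling_element :: "'a::chilbert_space set \<Rightarrow> ('a \<Rightarrow> 'a) \<Rightarrow> bool"
  where "scaling_element H X \<longleftrightarrow>
    bounded_op H H X \<and> (\<forall>x\<in>H. adj H X (X (X x)) = X x) \<and>
    \<not> (\<forall>x\<in>H. adj H X (X x) = X (adj H X x))"

definition l2_space :: "'a::chilbert_space set \<Rightarrow> 'a l2seq set"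
  where "l2_space H = {\<xi>. \<forall>n. l2_nth \<xi> n \<in> H}"

lift_definition wshift :: "('a::chilbert_space \<Rightarrow> 'a) \<Rightarrow> 'a l2seq \<Rightarrow> 'a l2seq"
  is "\<lambda>A \<xi> n. case n of 0 \<Rightarrow> 0 | Suc 0 \<Rightarrow> A (\<xi> 0) | Suc (Suc m) \<Rightarrow> \<xi> (Suc m)"
proof -
  fix A :: "'a \<Rightarrow> 'a" and \<xi> :: "nat \<Rightarrow> 'a"
  assume "summable (\<lambda>n. (norm (\<xi> n))\<^sup>2)"
  then have "summable (\<lambda>n. (norm (\<xi> (Suc n)))\<^sup>2)"
    by (simp only: summable_Suc_iff [where f = "\<lambda>n. (norm (\<xi> n))\<^sup>2"])
  then show "summable (\<lambda>n. (norm (case n of 0 \<Rightarrow> 0 | Suc 0 \<Rightarrow> A (\<xi> 0)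
      | Suc (Suc m) \<Rightarrow> \<xi> (Suc m)))\<^sup>2)"
    by (subst summable_iff_shift [where k = 2, symmetric]) simp
qed

definition decomposition ::
  "'a::chilbert_space set \<Rightarrow> ('a \<Rightarrow> 'a) \<Rightarrow> 'b::chilbert_space set \<Rightarrow> 'c::chilbert_space set \<Rightarrow>
    'd::chilbert_space set \<Rightarrow> ('b \<Rightarrow> 'b) \<Rightarrow> ('c \<Rightarrow> 'c) \<Rightarrow> bool"
  where "decomposition H X H1 H2 H3 A U \<longleftrightarrow>
    hilbert_space H1 \<and> hilbert_space H2 \<and> hilbert_space H3 \<and>
    positive_op H1 A \<and> is_support H1 A (\<lambda>x. x) \<and> unitary_op H2 H2 U \<and>
    (\<exists>\<Phi>. unitary_op H (l2_space H1 \<times> H2 \<times> H3) \<Phi> \<and>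
      (\<forall>x\<in>H. \<Phi> (X x) = map_prod (wshift A) (map_prod U (\<lambda>_. 0)) (\<Phi> x)))"


section \<open>Well-definedness\<close>

lemma hilbert_space_Times: "hilbert_space H \<Longrightarrow> hilbert_space K \<Longrightarrow> hilbert_space (H \<times> K)"
  by (auto simp: hilbert_space_def csubspace_def scaleC_prod_def closed_Times zero_prod_def)

lemma hilbert_space_l2_space:
  assumes "hilbert_space H"
  shows "hilbert_space (l2_space H)"
proof -
  have "closed (l2_space H)"
    unfolding closed_sequential_limits
  proof (intro allI impI, elim conjE)
    fix X :: "nat \<Rightarrow> 'a l2seq" and L
    assume X: "\<forall>n. X n \<in> l2_space H" and L: "X \<longlonglongrightarrow> L"
    have lim: "(\<lambda>n. l2_nth (X n) k) \<longlonglongrightarrow> l2_nth L k" for k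
    proof (rule metric_tendsto_imp_tendsto [OF L], rule always_eventually, rule allI)
      show "dist (l2_nth (X n) k) (l2_nth L k) \<le> dist (X n) L" for n
        using norm_l2_nth_le [of "X n - L" k] by (simp add: dist_norm minus_l2seq.rep_eq)
    qed
    have "closed H"
      using assms by (simp add: hilbert_space_def)
    moreover have "l2_nth (X n) k \<in> H" for n k
      using X by (simp add: l2_space_def)
    ultimately have "l2_nth L k \<in> H" for k
      by (rule closed_sequentially [where f = "\<lambda>n. l2_nth (X n) k"]) (rule lim)
    then show "L \<in> l2_space H"
      by (simp add: l2_space_def)
  qed
  then show ?thesis
    using assms by (auto simp: hilbert_space_def csubspace_def l2_space_def
        zero_l2seq.rep_eq plus_l2seq.rep_eq scaleC_l2seq.rep_eq)
qed

lemma csubspace_subspace: "csubspace H \<Longrightarrow> subspace H"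
  by (simp add: csubspace_def subspace_def scaleR_scaleC)

lemma riesz_representation:
  fixes H :: "'a::chilbert_space set" and f :: "'a \<Rightarrow> real"
  assumes H: "subspace H" "closed H"
    and add: "\<And>x y. x \<in> H \<Longrightarrow> y \<in> H \<Longrightarrow> f (x + y) = f x + f y"
    and scale: "\<And>r x. x \<in> H \<Longrightarrow> f (r *\<^sub>R x) = r * f x"
    and bd: "\<And>x. x \<in> H \<Longrightarrow> \<bar>f x\<bar> \<le> B * norm x"
  shows "\<exists>x\<in>H. \<forall>z\<in>H. f z = inner z x"
proof -
  define J where "J z = (norm z)\<^sup>2 - 2 * f z" for z
  have diff: "f (x - y) = f x - f y" if "x \<in> H" "y \<in> H" for x y
    using add [of x "(-1) *\<^sub>R y"] scale [of y "-1"] that H(1) by (simp add: subspace_neg)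
  have lower: "- B\<^sup>2 \<le> J z" if "z \<in> H" for z
  proof -
    have "0 \<le> (norm z - B)\<^sup>2" by simp
    then show ?thesis using bd [OF that] by (simp add: J_def power2_diff abs_le_iff algebra_simps)
  qed
  define m where "m = Inf (J ` H)"
  have ne: "J ` H \<noteq> {}" using H(1) subspace_0 by blast
  have bb: "bdd_below (J ` H)" unfolding bdd_below_def using lower by blast
  have mle: "m \<le> J z" if "z \<in> H" for z
    unfolding m_def using that bb by (intro cInf_lower) auto
  have "\<exists>z\<in>H. J z < m + 1 / Suc n" for n
    using cInf_lessD [OF ne, of "m + 1 / Suc n"] by (auto simp: m_def)
  then obtain z where z: "\<And>n. z n \<in> H" "\<And>n. J (z n) < m + 1 / Suc n" by metis
  have par: "(norm (x - y))\<^sup>2 \<le> 2 * (J x - m) + 2 * (J y - m)" if "x \<in> H" "y \<in> H" for x y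
  proof -
    let ?w = "(1/2) *\<^sub>R (x + y)"
    have w: "?w \<in> H" using that H(1) by (simp add: subspace_add subspace_scale)
    have "f ?w = (f x + f y) / 2" using that scale [of "x + y" "1/2"] add [of x y] H(1)
      by (simp add: subspace_add)
    moreover have "(norm (x - y))\<^sup>2 + 4 * (norm ?w)\<^sup>2 = 2 * (norm x)\<^sup>2 + 2 * (norm y)\<^sup>2"
      unfolding power2_norm_eq_inner
      by (simp add: inner_add_left inner_add_right inner_diff_left inner_diff_right inner_commute
          field_simps)
    ultimately show ?thesis using mle [OF w] by (simp add: J_def)
  qed
  have "Cauchy z"
  proof (rule CauchyI)
    fix e :: real assume e: "e > 0"
    obtain N where N: "1 / real (Suc N) < e\<^sup>2 / 4"
      using reals_Archimedean [of "e\<^sup>2 / 4"] e by (auto simp: inverse_eq_divide)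
    have "norm (z i - z j) < e" if "i \<ge> N" "j \<ge> N" for i j
    proof (rule power2_less_imp_less)
      have small: "J (z k) - m < e\<^sup>2 / 4" if "k \<ge> N" for k
      proof -
        have "J (z k) - m < 1 / real (Suc k)" using z(2) [of k] by (simp only: diff_less_eq add.commute)
        also have "\<dots> \<le> 1 / real (Suc N)" using that by (simp add: frac_le)
        also note N
        finally show ?thesis .
      qed
      show "(norm (z i - z j))\<^sup>2 < e\<^sup>2"
        using par [OF z(1) z(1), of i j] small [OF that(1)] small [OF that(2)] by simp
    qed (use e in simp)
    then show "\<exists>M. \<forall>m\<ge>M. \<forall>n\<ge>M. norm (z m - z n) < e" by blast
  qed
  then obtain x where x: "z \<longlonglongrightarrow> x" by (auto simp: Cauchy_convergent_iff convergent_def)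
  have xH: "x \<in> H" using H(2) z(1) x by (meson closed_sequentially)
  have fx: "(\<lambda>n. f (z n)) \<longlonglongrightarrow> f x"
  proof (rule Lim_transform_bound [where g = "\<lambda>n. B * norm (z n - x)", THEN Lim_null [THEN iffD2]])
    show "\<forall>\<^sub>F n in sequentially. norm (f (z n) - f x) \<le> norm (B * norm (z n - x))"
    proof (rule always_eventually, rule allI)
      show "norm (f (z n) - f x) \<le> norm (B * norm (z n - x))" for n
        using bd [of "z n - x"] z(1) xH H(1) by (simp add: diff subspace_diff)
    qed
    show "(\<lambda>n. B * norm (z n - x)) \<longlonglongrightarrow> 0"
      using tendsto_mult_right_zero [OF tendsto_norm_zero [OF LIM_zero [OF x]], of B] by simp
  qed
  have "J x \<le> m"
  proof (rule LIMSEQ_le)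
    show "(\<lambda>n. J (z n)) \<longlonglongrightarrow> J x" unfolding J_def by (intro tendsto_intros x fx)
    show "(\<lambda>n. m + 1 / Suc n) \<longlonglongrightarrow> m"
      using tendsto_add [OF tendsto_const LIMSEQ_inverse_real_of_nat, of m]
      by (simp add: inverse_eq_divide)
    show "\<exists>N. \<forall>n\<ge>N. J (z n) \<le> m + 1 / real (Suc n)" using z(2) less_imp_le by blast
  qed
  have "f y = inner y x" if y: "y \<in> H" for y
  proof -
    define d where "d = inner y x - f y"
    have key: "0 \<le> t\<^sup>2 * (norm y)\<^sup>2 + 2 * t * d" for t
    proof -
      have "J x \<le> J (x + t *\<^sub>R y)"
        using \<open>J x \<le> m\<close> mle [of "x + t *\<^sub>R y"] xH y H(1)
        by (simp add: subspace_add subspace_scale)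
      moreover have "(norm (x + t *\<^sub>R y))\<^sup>2 = (norm x)\<^sup>2 + t\<^sup>2 * (norm y)\<^sup>2 + 2 * t * inner y x"
        unfolding power2_norm_eq_inner
        by (simp add: inner_add_left inner_add_right inner_commute power2_eq_square)
      moreover have "f (x + t *\<^sub>R y) = f x + t * f y"
        using xH y H(1) by (simp add: add scale subspace_scale)
      ultimately show ?thesis by (simp add: J_def d_def algebra_simps)
    qed
    have "d = 0"
    proof (rule ccontr)
      assume d: "d \<noteq> 0"
      let ?s = "(norm y)\<^sup>2 + 1"
      have s: "?s > 0" using zero_le_power2 [of "norm y"] by linarith
      define u where "u = d / ?s"
      have u: "d = u * ?s" using s by (simp add: u_def)
      have "(- u)\<^sup>2 * (norm y)\<^sup>2 + 2 * (- u) * d = u\<^sup>2 * ((norm y)\<^sup>2 - 2 * ?s)"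
        unfolding u by (simp add: power2_eq_square algebra_simps)
      moreover have "u\<^sup>2 * ((norm y)\<^sup>2 - 2 * ?s) < 0"
      proof (rule mult_pos_neg)
        show "0 < u\<^sup>2" using d u by auto
        show "(norm y)\<^sup>2 - 2 * ?s < 0" using s by simp
      qed
      ultimately show False using key [of "- u"] by linarith
    qed
    then show ?thesis by (simp add: d_def)
  qed
  with xH show ?thesis by blast
qed

lemma adj_unique_exists:
  assumes H: "hilbert_space H" and T: "bounded_op H K T"
  shows "\<exists>!x. x \<in> H \<and> (\<forall>z\<in>H. cinner (T z) y = cinner z x)"
proof -
  have cs: "csubspace H" and sub: "subspace H" and cl: "closed H"
    using H csubspace_subspace by (auto simp: hilbert_space_def)
  obtain B where B: "\<And>z. z \<in> H \<Longrightarrow> norm (T z) \<le> B * norm z"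
    using T unfolding bounded_op_def by blast
  have "\<exists>x\<in>H. \<forall>z\<in>H. inner (T z) y = inner z x"
  proof (rule riesz_representation [OF sub cl])
    show "inner (T (u + v)) y = inner (T u) y + inner (T v) y" if "u \<in> H" "v \<in> H" for u v
      using T that by (simp add: bounded_op_def inner_add_left)
    show "inner (T (r *\<^sub>R u)) y = r * inner (T u) y" if "u \<in> H" for r u
      using T that by (simp add: bounded_op_def scaleR_scaleC inner_cinner cinner_scaleC_left)
    show "\<bar>inner (T u) y\<bar> \<le> (B * norm y) * norm u" if "u \<in> H" for u
      using Cauchy_Schwarz_ineq2 [of "T u" y] mult_right_mono [OF B [OF that], of "norm y"]
      by (simp add: ac_simps)
  qed
  then obtain x where x: "x \<in> H" "\<And>z. z \<in> H \<Longrightarrow> inner (T z) y = inner z x" by blast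
  have cx: "cinner (T z) y = cinner z x" if z: "z \<in> H" for z
  proof -
    have iz: "\<i> *\<^sub>C z \<in> H" using cs z by (simp add: csubspace_def)
    have "Re (\<i> * cinner (T z) y) = Re (\<i> * cinner z x)"
      using x(2) [OF iz] T z
      by (simp add: bounded_op_def inner_cinner cinner_scaleC_left)
    then show ?thesis using x(2) [OF z] by (simp add: complex_eq_iff inner_cinner)
  qed
  show ?thesis
  proof (rule ex1I [of _ x])
    fix x' assume x': "x' \<in> H \<and> (\<forall>z\<in>H. cinner (T z) y = cinner z x')"
    have xx: "x' - x \<in> H" using x' x(1) sub by (simp add: subspace_diff)
    then have "cinner (x' - x) x' = cinner (x' - x) x" using x' cx by metis
    then have "inner (x' - x) x' = inner (x' - x) x" by (simp only: inner_cinner)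
    then have "inner (x' - x) (x' - x) = 0" by (simp add: inner_diff_right)
    then show "x' = x" by simp
  qed (use x(1) cx in blast)
qed

end

(*
  The relation says that X* X is the identity on the range of X.  Let N be the orthogonal complement
  of the range and R that of N.  Then ker X lies in N, X maps R isometrically into R, and X maps N
  into E, the orthogonal complement of X R in R.  Put H3 = ker X, and let H1 be the orthogonal
  complement of ker X in N.  The restriction of X to H1 is injective with dense range in E, so its
  polar decomposition is V A with A positive and injective and V : H1 -> E unitary.  The operators
  1, V, X V, X^2 V, ... embed countably many orthogonal copies of H1 in H, and X acts on them as S_A;
  on the orthogonal complement H2 of these copies and of H3 it is unitary.

  For uniqueness, H3, the zeroth copy of H1, and H2 are recovered from X alone as ker X, as the
  orthogonal complement of range and kernel, and as the intersection of the ranges of the powers of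
  X; then A is the square root of the positive operator determined by <X e, X f>.

  The square root of T with 0 <= T <= 1 is 1 - Y, where Y is the limit of
  Y(n+1) = (1 - T + Y(n)^2) / 2.  The same iteration with the scalar 1 in place of 1 - T
  dominates the increments in norm, whence convergence.
*)
theory Submission
  imports Defs
begin

section \<open>Operators on closed subspaces\<close>

text \<open>On R the operator X is an isometry, and the construction is in essence the Wold
  decomposition of that isometry: E is its wandering subspace and H2 its unitary part. What goes
  beyond Wold is N, on which X need not be isometric; A records how the part of N orthogonal to the
  kernel is sent into E. Injectivity there makes the support of A the identity, and density in E
  makes V surjective.

  Closures are encoded by orthogonality: the closure of a range is a double orthogonal complement,
  density means that only 0 is orthogonal, and the orthogonal projection onto a closed subspace is
  the adjoint of its inclusion. Identities thus extend from a range to its closure without passing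
  to limits.

  Square roots are described by <S e, S f> = <C e, C f>, the form in which both halves meet them: C
  is X restricted to H1 for existence, and a candidate for A for uniqueness. The root constructed
  commutes with everything that commutes with the adjoint of C times C; uniqueness of roots rests on
  this and uses no spectral theory.\<close>

lemma cinner_zero_left [simp]: "cinner 0 (x::'a::complex_inner) = 0"
  using cinner_add_left [of 0 0 x] by simp

lemma cinner_zero_right [simp]: "cinner (x::'a::complex_inner) 0 = 0"
  using cinner_add_right [of x 0 0] by simp

lemma cinner_diff_left: "cinner (x - y) (z::'a::complex_inner) = cinner x z - cinner y z"
  using cinner_add_left [of "x - y" y z] by simp

lemma cinner_diff_right: "cinner (z::'a::complex_inner) (x - y) = cinner z x - cinner z y"
  using cinner_add_right [of z "x - y" y] by simp

lemma cinner_minus_left: "cinner (- x) (y::'a::complex_inner) = - cinner x y"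
  using cinner_diff_left [of 0 x y] by simp

lemma scaleC_zero_right [simp]: "a *\<^sub>C (0::'a::complex_vector) = 0"
  using scaleC_add_right [of a 0 "0::'a"] by simp

lemma scaleC_diff_right: "a *\<^sub>C (x - y) = a *\<^sub>C x - a *\<^sub>C (y::'a::complex_vector)"
  using scaleC_add_right [of a "x - y" y] by (simp add: algebra_simps)

lemma cinner_scaleR_left: "cinner (r *\<^sub>R x) (y::'a::complex_inner) = of_real r * cinner x y"
  by (simp add: scaleR_scaleC cinner_scaleC_left)

lemma cinner_scaleR_right: "cinner (x::'a::complex_inner) (r *\<^sub>R y) = of_real r * cinner x y"
  by (simp add: scaleR_scaleC cinner_scaleC_right)

lemmas cinner_distribs = cinner_add_left cinner_add_right cinner_diff_left cinner_diff_right

lemma cinner_eq_zero_swap: "cinner (x::'a::complex_inner) y = 0 \<longleftrightarrow> cinner y x = 0"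
  by (metis cinner_commute complex_cnj_zero)

lemma cinner_self_eq_zero [simp]: "cinner (x::'a::complex_inner) x = 0 \<longleftrightarrow> x = 0"
  by (simp add: cinner_self)

lemma tendsto_cinner_left:
  assumes "(f \<longlongrightarrow> (a::'a::complex_inner)) F"
  shows "((\<lambda>n. cinner (f n) y) \<longlongrightarrow> cinner a y) F"
  unfolding cinner_inner by (intro tendsto_Complex tendsto_intros assms)

lemma tendsto_cinner_right:
  assumes "(f \<longlongrightarrow> (a::'a::complex_inner)) F"
  shows "((\<lambda>n. cinner y (f n)) \<longlongrightarrow> cinner y a) F"
  using tendsto_cnj [OF tendsto_cinner_left [OF assms, of y]] by (simp flip: cinner_commute)

lemma tendsto_scaleC:
  assumes "(f \<longlongrightarrow> (a::'a::complex_inner)) F"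
  shows "((\<lambda>n. c *\<^sub>C f n) \<longlongrightarrow> c *\<^sub>C a) F"
proof (rule bounded_linear.tendsto [OF _ assms])
  show "bounded_linear (\<lambda>x::'a. c *\<^sub>C x)"
    by (rule bounded_linear_intro [where K = "cmod c"])
      (auto simp: scaleC_add_right norm_scaleC scaleR_scaleC scaleC_scaleC mult.commute)
qed

lemma hilbert_space_subspace: "hilbert_space H \<Longrightarrow> subspace H"
  by (simp add: hilbert_space_def csubspace_subspace)

lemma hilbert_spaceD:
  assumes "hilbert_space H"
  shows "0 \<in> H" "x \<in> H \<Longrightarrow> y \<in> H \<Longrightarrow> x + y \<in> H" "x \<in> H \<Longrightarrow> y \<in> H \<Longrightarrow> x - y \<in> H"
    "x \<in> H \<Longrightarrow> c *\<^sub>C x \<in> H" "x \<in> H \<Longrightarrow> r *\<^sub>R x \<in> H" "closed H"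
  using hilbert_space_subspace [OF assms] assms
  by (auto simp: hilbert_space_def csubspace_def intro: subspace_diff subspace_scale)

lemma cinner_eqI:
  assumes "hilbert_space H" "x \<in> H" "y \<in> H" "\<And>z. z \<in> H \<Longrightarrow> cinner z x = cinner z y"
  shows "x = y"
  using assms(4) [of "x - y"] hilbert_spaceD(3) [OF assms(1-3)]
  by (metis cinner_diff_right cinner_self_eq_zero eq_iff_diff_eq_0)

lemma bounded_opD:
  assumes "bounded_op H K T"
  shows "x \<in> H \<Longrightarrow> T x \<in> K" "x \<in> H \<Longrightarrow> y \<in> H \<Longrightarrow> T (x + y) = T x + T y"
    "x \<in> H \<Longrightarrow> T (c *\<^sub>C x) = c *\<^sub>C T x" "x \<in> H \<Longrightarrow> T (r *\<^sub>R x) = r *\<^sub>R T x"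
  using assms by (simp_all add: bounded_op_def scaleR_scaleC)

lemma bounded_op_zero: "bounded_op H K T \<Longrightarrow> hilbert_space H \<Longrightarrow> T 0 = 0"
  using bounded_opD(3) [of H K T 0 0] by (simp add: hilbert_spaceD)

lemma bounded_op_diff:
  assumes "bounded_op H K T" "hilbert_space H" "x \<in> H" "y \<in> H"
  shows "T (x - y) = T x - T y"
  using bounded_opD(2) [OF assms(1), of "x - y" y] assms by (simp add: hilbert_spaceD algebra_simps)

lemma bounded_op_bound:
  assumes "bounded_op H K T"
  obtains B where "B > 0" "\<And>x. x \<in> H \<Longrightarrow> norm (T x) \<le> B * norm x"
proof -
  obtain B where B: "\<And>x. x \<in> H \<Longrightarrow> norm (T x) \<le> B * norm x"
    using assms unfolding bounded_op_def by blast
  show thesis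
  proof (rule that [of "max B 1"])
    show "norm (T x) \<le> max B 1 * norm x" if "x \<in> H" for x
      using B [OF that] mult_right_mono [of B "max B 1" "norm x"] by simp
  qed simp
qed

lemma bounded_opI:
  assumes "\<And>x. x \<in> H \<Longrightarrow> T x \<in> K" "\<And>x y. x \<in> H \<Longrightarrow> y \<in> H \<Longrightarrow> T (x + y) = T x + T y"
    "\<And>c x. x \<in> H \<Longrightarrow> T (c *\<^sub>C x) = c *\<^sub>C T x" "\<And>x. x \<in> H \<Longrightarrow> norm (T x) \<le> B * norm x"
  shows "bounded_op H K T"
  using assms unfolding bounded_op_def by blast

lemma bounded_op_subset:
  "bounded_op H K T \<Longrightarrow> H' \<subseteq> H \<Longrightarrow> (\<And>x. x \<in> H' \<Longrightarrow> T x \<in> K') \<Longrightarrow> bounded_op H' K' T"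
  unfolding bounded_op_def by blast

lemma bounded_op_compose:
  assumes "bounded_op H K T" "bounded_op K L S"
  shows "bounded_op H L (\<lambda>x. S (T x))"
proof -
  obtain B where B: "\<And>x. x \<in> H \<Longrightarrow> norm (T x) \<le> B * norm x"
    using bounded_op_bound [OF assms(1)] by metis
  obtain B' where B': "B' > 0" "\<And>x. x \<in> K \<Longrightarrow> norm (S x) \<le> B' * norm x"
    using bounded_op_bound [OF assms(2)] by metis
  have "norm (S (T x)) \<le> B' * B * norm x" if "x \<in> H" for x
  proof -
    have "norm (S (T x)) \<le> B' * norm (T x)"
      by (rule B'(2) [OF bounded_opD(1) [OF assms(1) that]])
    also have "\<dots> \<le> B' * (B * norm x)"
      using B [OF that] B'(1) by (intro mult_left_mono) auto
    finally show ?thesis by (simp add: mult.assoc)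
  qed
  then show ?thesis
    using assms by (intro bounded_opI [where B = "B' * B"]) (simp_all add: bounded_opD)
qed

lemma bounded_op_funpow: "bounded_op H H T \<Longrightarrow> bounded_op H H (T ^^ n)"
proof (induction n)
  case 0
  show ?case by (rule bounded_opI [where B = 1]) auto
next
  case (Suc n)
  then show ?case using bounded_op_compose [of H H "T ^^ n" H T] by (simp add: comp_def)
qed

lemma bounded_op_id: "H \<subseteq> K \<Longrightarrow> bounded_op H K (\<lambda>x. x)"
  by (rule bounded_opI [where B = 1]) auto

section \<open>Adjoints, symmetric and positive operators\<close>

lemma adj_in:
  assumes "hilbert_space H" "bounded_op H K T"
  shows "adj H T y \<in> H"
  using theI' [OF adj_unique_exists [OF assms, of y]] unfolding adj_def by blast

lemma cinner_adj:
  assumes "hilbert_space H" "bounded_op H K T" "z \<in> H"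
  shows "cinner z (adj H T y) = cinner (T z) y"
  using theI' [OF adj_unique_exists [OF assms(1,2), of y]] assms(3) unfolding adj_def by auto

lemma cinner_adj_left:
  assumes "hilbert_space H" "bounded_op H K T" "z \<in> H"
  shows "cinner (adj H T y) z = cinner y (T z)"
  using cinner_adj [OF assms] by (metis cinner_commute)

lemma adj_eqI:
  assumes "hilbert_space H" "bounded_op H K T" "x \<in> H" "\<And>z. z \<in> H \<Longrightarrow> cinner z x = cinner (T z) y"
  shows "adj H T y = x"
  by (rule cinner_eqI [OF assms(1) adj_in [OF assms(1,2)] assms(3)])
    (simp add: assms cinner_adj [OF assms(1,2)])

text \<open>The bound comes from |T* y|^2 = <T T* y, y> after cancelling one factor. The domain
  \<open>L\<close> is arbitrary because the adjoint is defined at every vector of the ambient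
  type.\<close>

lemma bounded_op_adj:
  assumes H: "hilbert_space H" and T: "bounded_op H K T"
  shows "bounded_op L H (adj H T)"
proof -
  obtain B where B: "B > 0" "\<And>x. x \<in> H \<Longrightarrow> norm (T x) \<le> B * norm x"
    using bounded_op_bound [OF T] by metis
  have bd: "norm (adj H T y) \<le> B * norm y" for y
  proof (cases "norm (adj H T y) = 0")
    case False
    let ?a = "adj H T y"
    have "norm ?a * norm ?a = inner ?a ?a"
      by (simp add: dot_square_norm power2_eq_square)
    also have "\<dots> = inner (T ?a) y"
      by (simp add: inner_cinner cinner_adj [OF H T adj_in [OF H T]])
    also have "\<dots> \<le> norm (T ?a) * norm y"
      by (rule norm_cauchy_schwarz)
    also have "\<dots> \<le> (B * norm ?a) * norm y"
      by (intro mult_right_mono B adj_in [OF H T]) auto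
    finally have "norm ?a * norm ?a \<le> norm ?a * (B * norm y)"
      by (simp add: ac_simps)
    then show ?thesis
      using False by (simp add: mult_le_cancel_left)
  qed (use B in simp)
  show ?thesis
    by (rule bounded_opI [OF adj_in [OF H T] _ _ bd])
      (auto intro!: adj_eqI [OF H T] hilbert_spaceD(2,4) [OF H] adj_in [OF H T]
        simp: cinner_adj [OF H T] cinner_distribs cinner_scaleC_right)
qed

text \<open>Polarization: reality of the form at \<open>u + v\<close> makes the imaginary part of <A
  u, v> + <A v, u> vanish. The choices v = y and v = i y give the imaginary and the real part of the
  claim.\<close>

lemma symmetric_op_if_real:
  assumes H: "hilbert_space H" and A: "bounded_op H K A"
    and re: "\<And>x. x \<in> H \<Longrightarrow> cinner (A x) x \<in> \<real>" and xy: "x \<in> H" "y \<in> H"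
  shows "cinner (A x) y = cinner x (A y)"
proof -
  have p: "Im (cinner (A u) v) + Im (cinner (A v) u) = 0" if "u \<in> H" "v \<in> H" for u v
    using re [of "u + v"] re [of u] re [of v] that
    by (simp add: hilbert_spaceD [OF H] bounded_opD [OF A] cinner_distribs complex_is_Real_iff)
  have "Re (cinner (A x) y) = Re (cinner (A y) x)"
    using p [of x "\<i> *\<^sub>C y"] xy
    by (simp add: hilbert_spaceD [OF H] bounded_opD [OF A] cinner_scaleC_left cinner_scaleC_right)
  moreover have "Im (cinner (A x) y) = - Im (cinner (A y) x)"
    using p [OF xy] by simp
  ultimately have "cinner (A x) y = cnj (cinner (A y) x)"
    by (simp add: complex_eq_iff)
  then show ?thesis
    by (metis cinner_commute)
qed

lemma positive_op_symmetric:
  assumes "hilbert_space H" "positive_op H A" "x \<in> H" "y \<in> H"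
  shows "cinner (A x) y = cinner x (A y)"
  using assms unfolding positive_op_def
  by (intro symmetric_op_if_real [of H H]) (auto dest: nonneg_Reals_subset_Reals [THEN subsetD])

text \<open>Along y + t A y the form of \<open>A\<close> is a quadratic polynomial in t with zero
  constant term and linear coefficient 2 |A y|^2; it would be negative for small negative t if A y
  were nonzero.\<close>

lemma positive_op_eq_zero:
  assumes H: "hilbert_space H" and A: "positive_op H A" and y: "y \<in> H" "cinner (A y) y = 0"
  shows "A y = 0"
proof (rule ccontr)
  assume ne: "A y \<noteq> 0"
  have bA: "bounded_op H H A"
    using A by (simp add: positive_op_def)
  define z where "z = A y"
  define c where "c = Re (cinner (A z) z)"
  have z: "z \<in> H"
    using bA y by (simp add: z_def bounded_opD)
  have q: "0 \<le> 2 * t * (norm z)\<^sup>2 + t\<^sup>2 * c" for t :: real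
  proof -
    have "0 \<le> Re (cinner (A (y + t *\<^sub>R z)) (y + t *\<^sub>R z))"
      using A y z unfolding positive_op_def
      by (auto simp: complex_nonneg_Reals_iff hilbert_spaceD [OF H])
    also have "\<dots> = 2 * t * (norm z)\<^sup>2 + t\<^sup>2 * c"
      using y z positive_op_symmetric [OF H A z y(1)]
      by (simp add: bounded_opD [OF bA] hilbert_spaceD [OF H] cinner_distribs cinner_scaleR_left
          cinner_scaleR_right c_def power2_eq_square algebra_simps flip: z_def)
        (simp add: cinner_self power2_eq_square)
    finally show ?thesis .
  qed
  have c: "c \<ge> 0"
    using A z unfolding positive_op_def c_def by (auto simp: complex_nonneg_Reals_iff)
  have n: "(norm z)\<^sup>2 > 0"
    using ne by (simp add: z_def)
  \<comment> \<open>The summand 1 keeps the denominator positive when \<open>c\<close> is 0.\<close>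
  define t where "t = - (norm z)\<^sup>2 / (c + 1)"
  have t: "t < 0" "t * (c + 1) = - (norm z)\<^sup>2"
    using n c by (simp_all add: t_def divide_neg_pos)
  have "0 \<le> t * (2 * (norm z)\<^sup>2 + t * c)"
    using q [of t] by (simp add: power2_eq_square algebra_simps)
  then have "2 * (norm z)\<^sup>2 + t * c \<le> 0"
    using t by (simp add: zero_le_mult_iff)
  moreover have "t * c = - (norm z)\<^sup>2 - t"
    using t(2) by (simp add: algebra_simps)
  ultimately show False
    using n t by linarith
qed

section \<open>Positive square roots\<close>

text \<open>The scalar majorant of the operator iteration. Its increment is (1 - y n)^2 / 2, so the
  sequence increases, and the bound 1 is preserved by the recursion.\<close>

lemma convergent_square_iteration:
  fixes y :: "nat \<Rightarrow> real"
  assumes y0: "y 0 = 0" and ySuc: "\<And>n. y (Suc n) = (1 + (y n)\<^sup>2) / 2"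
  shows "0 \<le> y n" "y n \<le> 1" "y n \<le> y (Suc n)" "convergent y"
proof -
  have nn: "0 \<le> y n" for n by (cases n) (auto simp: y0 ySuc)
  have le1: "y n \<le> 1" for n
  proof (induction n)
    case (Suc n)
    then show ?case using nn [of n] by (simp add: ySuc power_le_one)
  qed (simp add: y0)
  have inc: "y n \<le> y (Suc n)" for n
    using zero_le_power2 [of "1 - y n"] by (simp add: ySuc power2_diff)
  show "0 \<le> y n" "y n \<le> 1" "y n \<le> y (Suc n)" by (rule nn le1 inc)+
  show "convergent y"
    using incseq_convergent [of y 1] incseq_SucI [of y] inc le1 by (metis convergentI)
qed

text \<open>With \<open>T\<close> the adjoint of \<open>C\<close> times \<open>C\<close>, the
  contraction hypothesis gives 0 <= T <= 1, where the iteration converges strongly. The clause about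
  \<open>D\<close> serves the uniqueness of positive roots.\<close>

lemma sqrt_of_contraction:
  assumes H: "hilbert_space H" and C: "bounded_op H K C"
    and contr: "\<And>x. x \<in> H \<Longrightarrow> norm (C x) \<le> norm x"
  shows "\<exists>S. positive_op H S \<and> (\<forall>x\<in>H. \<forall>y\<in>H. cinner (S x) (S y) = cinner (C x) (C y)) \<and>
    (\<forall>D. bounded_op H H D \<longrightarrow> (\<forall>x\<in>H. D (adj H C (C x)) = adj H C (C (D x))) \<longrightarrow>
      (\<forall>x\<in>H. D (S x) = S (D x)))"
proof -
  note hs = hilbert_spaceD [OF H]
  define T where "T x = adj H C (C x)" for x
  have T: "bounded_op H H T"
    unfolding T_def using bounded_op_compose [OF C bounded_op_adj [OF H C]] .
  have TC: "cinner z (T x) = cinner (C z) (C x)" if "z \<in> H" for z x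
    by (simp add: T_def cinner_adj [OF H C that])
  \<comment> \<open>This prepares the bound on M = 1 - T: expanding gives |M x|^2 = |x|^2 - 2 |C
    x|^2 + |T x|^2, so it suffices that |T x| is at most |C x|.\<close>
  have T_le: "norm (T x) \<le> norm (C x)" if x: "x \<in> H" for x
  proof (cases "T x = 0")
    case False
    have "norm (T x) * norm (T x) = inner (T x) (T x)"
      by (simp add: dot_square_norm power2_eq_square)
    also have "\<dots> = inner (C (T x)) (C x)"
      by (simp add: inner_cinner TC bounded_opD [OF T] x)
    also have "\<dots> \<le> norm (C (T x)) * norm (C x)" by (rule norm_cauchy_schwarz)
    also have "\<dots> \<le> norm (T x) * norm (C x)"
      by (intro mult_right_mono contr bounded_opD [OF T] x) auto
    finally show ?thesis using False by simp
  qed simp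
  define M where "M x = x - T x" for x
  have M_le: "norm (M x) \<le> norm x" if x: "x \<in> H" for x
  proof (rule power2_le_imp_le)
    have "(norm (M x))\<^sup>2 = (norm x)\<^sup>2 - 2 * inner x (T x) + (norm (T x))\<^sup>2"
      unfolding M_def power2_norm_eq_inner by (simp add: inner_diff inner_commute)
    also have "inner x (T x) = (norm (C x))\<^sup>2"
      by (simp add: inner_cinner TC x cinner_self)
    also have "(norm x)\<^sup>2 - 2 * (norm (C x))\<^sup>2 + (norm (T x))\<^sup>2 \<le> (norm x)\<^sup>2"
      using power_mono [OF T_le [OF x] norm_ge_zero, of 2] zero_le_power2 [of "norm (C x)"] by linarith
    finally show "(norm (M x))\<^sup>2 \<le> (norm x)\<^sup>2" .
  qed simp
  have M: "bounded_op H H M"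
    by (rule bounded_opI [where B = 1])
      (use M_le in \<open>auto simp: M_def hs bounded_opD [OF T] scaleC_diff_right\<close>)

  define Y where "Y = rec_nat (\<lambda>_. 0) (\<lambda>_ f x. (1/2) *\<^sub>R (M x + f (f x)))"
  have Y0: "Y 0 x = 0" and YSuc: "Y (Suc n) x = (1/2) *\<^sub>R (M x + Y n (Y n x))" for n x
    by (simp_all add: Y_def)
  define y :: "nat \<Rightarrow> real" where "y = rec_nat 0 (\<lambda>_ r. (1 + r\<^sup>2) / 2)"
  have y0: "y 0 = 0" and ySuc: "y (Suc n) = (1 + (y n)\<^sup>2) / 2" for n
    by (simp_all add: y_def)
  note y = convergent_square_iteration [of y, OF y0 ySuc]

  have Yin: "Y n x \<in> H" if "x \<in> H" for n x
    using that by (induction n arbitrary: x) (auto simp: Y0 YSuc hs bounded_opD [OF M])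
  have Y_add: "Y n (u + v) = Y n u + Y n v" if "u \<in> H" "v \<in> H" for n u v
    using that
    by (induction n arbitrary: u v)
      (auto simp: Y0 YSuc hs bounded_opD [OF M] Yin scaleR_add_right)
  have Y_scale: "Y n (c *\<^sub>C u) = c *\<^sub>C Y n u" if "u \<in> H" for n c u
    using that
    by (induction n arbitrary: u)
      (auto simp: Y0 YSuc hs bounded_opD [OF M] Yin scaleR_scaleC scaleC_add_right scaleC_scaleC
        mult.commute)
  have Y_le: "norm (Y n x) \<le> y n * norm x" if "x \<in> H" for n x
    using that
  proof (induction n arbitrary: x)
    case (Suc n)
    have "norm (Y n (Y n x)) \<le> y n * (y n * norm x)"
      using Suc.IH [OF Yin [OF Suc.prems]] mult_left_mono [OF Suc.IH [OF Suc.prems] y(1) [of n]]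
      by (meson order_trans)
    then have "norm (M x + Y n (Y n x)) \<le> norm x + y n * (y n * norm x)"
      using M_le [OF Suc.prems] norm_triangle_ineq [of "M x" "Y n (Y n x)"] by linarith
    moreover have "y (Suc n) * norm x = (norm x + y n * (y n * norm x)) / 2"
      by (simp add: ySuc power2_eq_square distrib_right)
    ultimately show ?case by (simp add: YSuc del: scaleR_add_right)
  qed (simp add: Y0 y0)
  have bY: "bounded_op H H (Y n)" for n
    by (rule bounded_opI [OF Yin Y_add Y_scale Y_le])
  have Y_step: "norm (Y (Suc n) x - Y n x) \<le> (y (Suc n) - y n) * norm x" if "x \<in> H" for n x
    using that
  proof (induction n arbitrary: x)
    case 0
    then show ?case using M_le [of x] by (simp add: YSuc ySuc Y0 y0)
  next
    case (Suc n)
    let ?d = "Y (Suc n) x - Y n x" and ?e = "y (Suc n) - y n"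
    have d: "?d \<in> H" by (intro hs Yin Suc.prems)
    \<comment> \<open>The factorization a^2 - b^2 = a (a - b) + (a - b) b keeps the order of the
      operators. The scalar sequence obeys the same identity, so the two estimates that follow add
      up exactly to its increment.\<close>
    have "Y (Suc (Suc n)) x - Y (Suc n) x =
        (1/2) *\<^sub>R (Y (Suc n) ?d + (Y (Suc n) (Y n x) - Y n (Y n x)))"
      unfolding bounded_op_diff [OF bY H Yin [OF Suc.prems] Yin [OF Suc.prems]]
      by (simp add: YSuc [of "Suc n" x] YSuc [of n x] flip: scaleR_diff_right)
    moreover have "norm (Y (Suc n) ?d) \<le> y (Suc n) * (?e * norm x)"
      using Y_le [OF d, of "Suc n"] mult_left_mono [OF Suc.IH [OF Suc.prems] y(1) [of "Suc n"]]
      by (meson order_trans)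
    moreover have "norm (Y (Suc n) (Y n x) - Y n (Y n x)) \<le> ?e * (y n * norm x)"
    proof -
      have "?e \<ge> 0" using y(3) [of n] by simp
      from Suc.IH [OF Yin [OF Suc.prems], of n] mult_left_mono [OF Y_le [OF Suc.prems] this, of n]
      show ?thesis by (meson order_trans)
    qed
    ultimately have "norm (Y (Suc (Suc n)) x - Y (Suc n) x)
        \<le> (y (Suc n) * (?e * norm x) + ?e * (y n * norm x)) / 2"
      using norm_triangle_ineq [of "Y (Suc n) ?d" "Y (Suc n) (Y n x) - Y n (Y n x)"] by simp
    also have "\<dots> = (y (Suc (Suc n)) - y (Suc n)) * norm x"
    proof -
      have "y (Suc (Suc n)) - y (Suc n) = ((y (Suc n))\<^sup>2 - (y n)\<^sup>2) / 2"
        by (subst ySuc [of "Suc n"], subst (2) ySuc [of n]) (simp add: diff_divide_distrib add_divide_distrib)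
      also have "\<dots> = (y (Suc n) * ?e + ?e * y n) / 2"
        by (simp add: power2_eq_square algebra_simps)
      finally have step: "y (Suc (Suc n)) - y (Suc n) = (y (Suc n) * ?e + ?e * y n) / 2" .
      show ?thesis unfolding step by (simp add: algebra_simps)
    qed
    finally show ?case .
  qed
  have Y_diff: "norm (Y m x - Y n x) \<le> (y m - y n) * norm x" if "x \<in> H" "n \<le> m" for m n x
    using that(2)
  proof (induction m rule: dec_induct)
    case (step m)
    then show ?case
      using Y_step [OF that(1), of m] norm_triangle_ineq [of "Y (Suc m) x - Y m x" "Y m x - Y n x"]
      by (simp add: algebra_simps)
  qed simp
  have conv: "convergent (\<lambda>n. Y n x)" if x: "x \<in> H" for x
  proof -
    have "Cauchy y" using y(4) by (simp add: Cauchy_convergent_iff)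
    have "Cauchy (\<lambda>n. Y n x)"
    proof (rule CauchyI)
      fix e :: real assume e: "e > 0"
      have pos: "norm x + 1 > 0" by (simp add: add_nonneg_pos)
      then obtain N where N: "\<And>m n. m \<ge> N \<Longrightarrow> n \<ge> N \<Longrightarrow> norm (y m - y n) < e / (norm x + 1)"
        using CauchyD [OF \<open>Cauchy y\<close>, of "e / (norm x + 1)"] e by auto
      have bd: "norm (Y m x - Y n x) < e" if "n \<ge> N" "m \<ge> n" for m n
      proof -
        have "norm (Y m x - Y n x) \<le> norm (y m - y n) * norm x"
          using Y_diff [OF x that(2)] mult_right_mono [OF abs_ge_self [of "y m - y n"] norm_ge_zero [of x]]
          unfolding real_norm_def by (rule order_trans)
        also have "\<dots> \<le> norm (y m - y n) * (norm x + 1)" by (intro mult_left_mono) auto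
        also have "\<dots> < e" using N [of m n] that pos by (simp add: pos_less_divide_eq)
        finally show ?thesis .
      qed
      then have "norm (Y m x - Y n x) < e" if "n \<ge> N" "m \<ge> N" for m n
        using bd [of n m] bd [of m n] that by (cases "m \<ge> n") (auto simp: norm_minus_commute)
      then show "\<exists>N. \<forall>m\<ge>N. \<forall>n\<ge>N. norm (Y m x - Y n x) < e" by blast
    qed
    then show ?thesis by (simp add: Cauchy_convergent_iff)
  qed
  define L where "L x = lim (\<lambda>n. Y n x)" for x
  have L: "(\<lambda>n. Y n x) \<longlonglongrightarrow> L x" if "x \<in> H" for x
    using conv [OF that] by (simp add: L_def convergent_LIMSEQ_iff)
  have L_in: "L x \<in> H" if "x \<in> H" for x
    using closed_sequentially [OF hs(6) _ L [OF that]] Yin [OF that] by blast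
  have L_le: "norm (L x) \<le> norm x" if x: "x \<in> H" for x
  proof (rule LIMSEQ_le_const2 [OF tendsto_norm [OF L [OF x]]])
    have "norm (Y n x) \<le> norm x" for n
      using Y_le [OF x, of n] mult_right_mono [OF y(2) [of n], of "norm x"] by simp
    then show "\<exists>N. \<forall>n\<ge>N. norm (Y n x) \<le> norm x" by blast
  qed
  have bL: "bounded_op H H L"
  proof (rule bounded_opI [OF L_in])
    show "L (u + v) = L u + L v" if "u \<in> H" "v \<in> H" for u v
      using LIMSEQ_unique [OF L [OF hs(2) [OF that]]] tendsto_add [OF L [OF that(1)] L [OF that(2)]]
      by (simp add: Y_add that)
    show "L (c *\<^sub>C u) = c *\<^sub>C L u" if "u \<in> H" for c u
      using LIMSEQ_unique [OF L [OF hs(4) [OF that]]] tendsto_scaleC [OF L [OF that], of c]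
      by (simp add: Y_scale that)
    show "norm (L u) \<le> 1 * norm u" if "u \<in> H" for u using L_le [OF that] by simp
  qed
  have L_fix: "L x = (1/2) *\<^sub>R (M x + L (L x))" if x: "x \<in> H" for x
  proof (rule LIMSEQ_unique)
    show "(\<lambda>n. Y (Suc n) x) \<longlonglongrightarrow> L x" using L [OF x] by (rule LIMSEQ_Suc)
    \<comment> \<open>Strong convergence passes to the square by writing Y n (Y n x) as Y n (Y n x -
      L x) + Y n (L x), all \<open>Y n\<close> being contractions.\<close>
    have "(\<lambda>n. Y n (Y n x - L x)) \<longlonglongrightarrow> 0"
    proof (rule Lim_null_comparison)
      have "norm (Y n (Y n x - L x)) \<le> norm (Y n x - L x)" for n
        using Y_le [OF hs(3) [OF Yin [OF x] L_in [OF x]], of n n]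
          mult_right_mono [OF y(2) [of n], of "norm (Y n x - L x)"] by simp
      then show "\<forall>\<^sub>F n in sequentially. norm (Y n (Y n x - L x)) \<le> norm (Y n x - L x)" by simp
      show "(\<lambda>n. norm (Y n x - L x)) \<longlonglongrightarrow> 0"
        using L [OF x] by (intro tendsto_norm_zero LIM_zero)
    qed
    from tendsto_add [OF this L [OF L_in [OF x]]]
    have "(\<lambda>n. Y n (Y n x)) \<longlonglongrightarrow> L (L x)"
      by (simp add: bounded_op_diff [OF bY H Yin [OF x] L_in [OF x]])
    then show "(\<lambda>n. Y (Suc n) x) \<longlonglongrightarrow> (1/2) *\<^sub>R (M x + L (L x))"
      unfolding YSuc by (intro tendsto_intros)
  qed
  have L_sym: "cinner (L u) v = cinner u (L v)" if uv: "u \<in> H" "v \<in> H" for u v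
  proof (rule LIMSEQ_unique [OF tendsto_cinner_left [OF L [OF uv(1)]]])
    have T_sym: "cinner (T u) v = cinner u (T v)" if "u \<in> H" "v \<in> H" for u v
      using TC [OF that(1), of v] TC [OF that(2), of u] by (metis cinner_commute)
    have "cinner (Y n u) v = cinner u (Y n v)" for n
      using uv
    proof (induction n arbitrary: u v)
      case (Suc n)
      have "cinner (Y n (Y n u)) v = cinner u (Y n (Y n v))"
        using Suc.IH [OF Yin [OF Suc.prems(1)] Suc.prems(2)]
          Suc.IH [OF Suc.prems(1) Yin [OF Suc.prems(2)]] by simp
      then show ?case
        using Suc.prems
        by (simp add: YSuc M_def cinner_scaleR_left cinner_scaleR_right cinner_distribs T_sym)
    qed (simp add: Y0)
    then show "(\<lambda>n. cinner (Y n u) v) \<longlonglongrightarrow> cinner u (L v)"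
      using tendsto_cinner_right [OF L [OF uv(2)], of u] by simp
  qed

  define S where "S x = x - L x" for x
  have bS: "bounded_op H H S"
    by (rule bounded_opI [where B = 2])
      (auto simp: S_def hs bounded_opD [OF bL] scaleC_diff_right
        intro!: order_trans [OF norm_triangle_ineq4] dest: L_le)
  have S_sym: "cinner (S u) v = cinner u (S v)" if "u \<in> H" "v \<in> H" for u v
    using L_sym [OF that] by (simp add: S_def cinner_distribs)
  have SS: "S (S x) = T x" if x: "x \<in> H" for x
  proof -
    \<comment> \<open>The fixed point equation turns (1 - L)^2 = 1 - 2 L + L^2 into 1 - M =
      T.\<close>
    have "2 *\<^sub>R L x = M x + L (L x)" by (subst L_fix [OF x]) simp
    then have "L (L x) = 2 *\<^sub>R L x - M x" by simp
    then show ?thesis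
      using x by (simp add: S_def bounded_op_diff [OF bL H] L_in M_def scaleR_2)
  qed
  have "positive_op H S"
    unfolding positive_op_def
  proof (intro conjI bS ballI)
    fix x assume x: "x \<in> H"
    have "Im (cinner (S x) x) = 0"
      using S_sym [OF x x] by (metis cinner_commute cnj.simps(2) equal_neg_zero)
    moreover have "Re (cinner (S x) x) \<ge> 0"
      using norm_cauchy_schwarz [of "L x" x] mult_right_mono [OF L_le [OF x], of "norm x"]
      by (simp add: S_def flip: inner_cinner)
        (simp add: inner_diff_left dot_square_norm power2_eq_square)
    ultimately show "cinner (S x) x \<in> \<real>\<^sub>\<ge>\<^sub>0" by (simp add: complex_nonneg_Reals_iff)
  qed
  moreover have "cinner (S x) (S v) = cinner (C x) (C v)" if "x \<in> H" "v \<in> H" for x v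
    using S_sym [OF that(1) bounded_opD(1) [OF bS that(2)]] SS [OF that(2)] TC [OF that(1), of v]
    by simp
  moreover have "D (S x) = S (D x)"
    if D: "bounded_op H H D" and comm: "\<And>x. x \<in> H \<Longrightarrow> D (T x) = T (D x)" and x: "x \<in> H" for D x
  proof -
    \<comment> \<open>Every \<open>Y n\<close> is a polynomial in \<open>M\<close>, so it commutes
      with whatever commutes with \<open>T\<close>; boundedness of \<open>D\<close> then carries
      this to the limit.\<close>
    have YD: "D (Y n x) = Y n (D x)" for n
      using x
    proof (induction n arbitrary: x)
      case (Suc n)
      then show ?case
        by (simp add: YSuc bounded_opD [OF D] hs Yin bounded_opD [OF M] Suc.IH M_def
            bounded_op_diff [OF D H] bounded_opD [OF T] comm)
    qed (simp add: Y0 bounded_op_zero [OF D H])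
    obtain B where B: "\<And>x. x \<in> H \<Longrightarrow> norm (D x) \<le> B * norm x"
      using bounded_op_bound [OF D] by metis
    have "(\<lambda>n. D (Y n x) - D (L x)) \<longlonglongrightarrow> 0"
    proof (rule Lim_null_comparison)
      have "norm (D (Y n x) - D (L x)) \<le> B * norm (Y n x - L x)" for n
        using B [OF hs(3) [OF Yin [OF x] L_in [OF x]], of n]
        by (simp add: bounded_op_diff [OF D H Yin [OF x] L_in [OF x]])
      then show "\<forall>\<^sub>F n in sequentially. norm (D (Y n x) - D (L x)) \<le> B * norm (Y n x - L x)" by simp
      show "(\<lambda>n. B * norm (Y n x - L x)) \<longlonglongrightarrow> 0"
        using L [OF x] by (intro tendsto_mult_right_zero tendsto_norm_zero LIM_zero)
    qed
    then have "(\<lambda>n. Y n (D x)) \<longlonglongrightarrow> D (L x)" by (simp add: YD LIM_zero_iff)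
    from LIMSEQ_unique [OF this L [OF bounded_opD(1) [OF D x]]]
    show ?thesis by (simp add: S_def bounded_op_diff [OF D H x L_in [OF x]])
  qed
  ultimately show ?thesis unfolding T_def by blast
qed

text \<open>Dividing \<open>C\<close> by a bound \<open>B\<close> makes it a contraction, and
  multiplying the resulting root by \<open>B\<close> undoes this; the commutation condition is
  unaffected by the scaling.\<close>

lemma positive_sqrt_exists:
  assumes H: "hilbert_space H" and C: "bounded_op H K C"
  shows "\<exists>S. positive_op H S \<and> (\<forall>x\<in>H. \<forall>y\<in>H. cinner (S x) (S y) = cinner (C x) (C y)) \<and>
    (\<forall>D. bounded_op H H D \<longrightarrow> (\<forall>x\<in>H. D (adj H C (C x)) = adj H C (C (D x))) \<longrightarrow>
      (\<forall>x\<in>H. D (S x) = S (D x)))"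
proof -
  note hs = hilbert_spaceD [OF H]
  obtain B where B: "B > 0" "\<And>x. x \<in> H \<Longrightarrow> norm (C x) \<le> B * norm x"
    using bounded_op_bound [OF C] by metis
  define C' where "C' x = C ((1/B) *\<^sub>R x)" for x
  have bs: "bounded_op H H (\<lambda>x. r *\<^sub>R x)" for r
    by (rule bounded_opI [where B = "\<bar>r\<bar>"])
      (auto simp: hs scaleC_add_right scaleR_scaleC scaleC_scaleC mult.commute norm_scaleC)
  have C': "bounded_op H K C'"
    unfolding C'_def using bounded_op_compose [OF bs C] .
  have C'_eq: "C' x = (1/B) *\<^sub>R C x" if "x \<in> H" for x
    using that by (simp add: C'_def bounded_opD(4) [OF C])
  have "norm (C' x) \<le> norm x" if "x \<in> H" for x
    using B(2) [OF that] B(1) that by (simp add: C'_eq field_simps)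
  from sqrt_of_contraction [OF H C' this] obtain S where S: "positive_op H S"
    "\<And>x y. x \<in> H \<Longrightarrow> y \<in> H \<Longrightarrow> cinner (S x) (S y) = cinner (C' x) (C' y)"
    and comm: "\<And>D x. bounded_op H H D \<Longrightarrow> (\<forall>x\<in>H. D (adj H C' (C' x)) = adj H C' (C' (D x))) \<Longrightarrow>
      x \<in> H \<Longrightarrow> D (S x) = S (D x)" by blast
  have bS: "bounded_op H H S" using S(1) by (simp add: positive_op_def)
  have adj': "adj H C' (C' x) = (1/B\<^sup>2) *\<^sub>R adj H C (C x)" if "x \<in> H" for x
    by (rule adj_eqI [OF H C'])
      (auto simp: hs adj_in [OF H C] cinner_scaleR_right cinner_scaleR_left cinner_adj [OF H C]
        C'_eq that power2_eq_square)
  show ?thesis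
  proof (intro exI conjI ballI allI impI)
    show "positive_op H (\<lambda>x. B *\<^sub>R S x)"
      using S(1) B(1) bounded_op_compose [OF bS bs]
      by (auto simp: positive_op_def cinner_scaleR_left intro!: nonneg_Reals_mult_I)
    show "cinner (B *\<^sub>R S x) (B *\<^sub>R S y) = cinner (C x) (C y)" if "x \<in> H" "y \<in> H" for x y
      using S(2) [OF that] B(1) that
      by (simp add: cinner_scaleR_left cinner_scaleR_right C'_eq)
    show "D (B *\<^sub>R S x) = B *\<^sub>R S (D x)"
      if D: "bounded_op H H D" "\<forall>x\<in>H. D (adj H C (C x)) = adj H C (C (D x))" and x: "x \<in> H" for D x
    proof -
      have "D (adj H C' (C' x)) = adj H C' (C' (D x))" if "x \<in> H" for x
        using that D by (simp add: adj' bounded_opD [OF D(1)] adj_in [OF H C])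
      then show ?thesis
        using comm [OF D(1) _ x] x by (simp add: bounded_opD [OF D(1)] bounded_opD [OF bS])
    qed
  qed
qed

text \<open>Both operators are compared with the root \<open>S\<close> constructed from
  \<open>A\<close>. Any positive root \<open>D\<close> of the same form commutes with its own
  square, which is the operator that \<open>S\<close> is built from, hence with
  \<open>S\<close>.\<close>

lemma positive_sqrt_unique:
  assumes H: "hilbert_space H" and A: "positive_op H A" and B: "positive_op H B"
    and AB: "\<And>x y. x \<in> H \<Longrightarrow> y \<in> H \<Longrightarrow> cinner (A x) (A y) = cinner (B x) (B y)"
    and x: "x \<in> H"
  shows "A x = B x"
proof -
  note hs = hilbert_spaceD [OF H]
  have bA: "bounded_op H H A" using A by (simp add: positive_op_def)
  obtain S where S: "positive_op H S"
    "\<And>x y. x \<in> H \<Longrightarrow> y \<in> H \<Longrightarrow> cinner (S x) (S y) = cinner (A x) (A y)"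
    and comm: "\<And>D x. bounded_op H H D \<Longrightarrow> (\<forall>x\<in>H. D (adj H A (A x)) = adj H A (A (D x))) \<Longrightarrow>
      x \<in> H \<Longrightarrow> D (S x) = S (D x)"
    using positive_sqrt_exists [OF H bA] by blast
  have bS: "bounded_op H H S" using S by (simp add: positive_op_def)
  have eqS: "D x = S x" if D: "positive_op H D"
    and DA: "\<And>x y. x \<in> H \<Longrightarrow> y \<in> H \<Longrightarrow> cinner (D x) (D y) = cinner (A x) (A y)" for D
  proof -
    have bD: "bounded_op H H D" using D by (simp add: positive_op_def)
    note in_H = hs bounded_opD(1) [OF bD] bounded_opD(1) [OF bS] x
    have sq: "adj H A (A u) = D (D u)" if "u \<in> H" for u
      by (rule adj_eqI [OF H bA])
        (simp_all add: in_H that DA [symmetric] flip: positive_op_symmetric [OF H D])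
    have DS: "D (S u) = S (D u)" if "u \<in> H" for u
      by (rule comm [OF bD _ that]) (simp add: sq in_H)
    have SS: "S (S u) = D (D u)" if u: "u \<in> H" for u
    proof (rule cinner_eqI [OF H])
      fix z assume z: "z \<in> H"
      show "cinner z (S (S u)) = cinner z (D (D u))"
        using positive_op_symmetric [OF H D z, of "D u"] positive_op_symmetric [OF H S(1) z, of "S u"]
        by (simp add: in_H u z S(2) DA)
    qed (simp_all add: in_H u)
    define y where "y = D x - S x"
    have y: "y \<in> H" by (simp add: y_def in_H)
    \<comment> \<open>This is (D + S)(D - S) = D^2 - S^2 = 0 for commuting \<open>D\<close> and
      \<open>S\<close>. Positivity then annihilates \<open>y\<close> under both, and symmetry moves
      \<open>D\<close> and \<open>S\<close> from \<open>x\<close> onto \<open>y\<close> in <y,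
      y>.\<close>
    have "D y + S y = 0"
      by (simp add: y_def bounded_op_diff [OF bD H] bounded_op_diff [OF bS H] in_H SS DS)
    then have "cinner (D y) y + cinner (S y) y = 0"
      by (simp flip: cinner_add_left)
    moreover have "cinner (D y) y \<in> \<real>\<^sub>\<ge>\<^sub>0" "cinner (S y) y \<in> \<real>\<^sub>\<ge>\<^sub>0"
      using D S(1) y by (auto simp: positive_op_def)
    ultimately have "cinner (D y) y = 0" "cinner (S y) y = 0"
      by (auto simp: complex_nonneg_Reals_iff complex_eq_iff)
    then have 0: "D y = 0" "S y = 0"
      using positive_op_eq_zero [OF H D y] positive_op_eq_zero [OF H S(1) y] by auto
    have "cinner y y = cinner (D x) y - cinner (S x) y"
      by (simp add: y_def cinner_diff_left)
    also have "\<dots> = 0"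
      by (simp add: positive_op_symmetric [OF H D x y] positive_op_symmetric [OF H S(1) x y] 0)
    finally show ?thesis by (simp add: y_def)
  qed
  show ?thesis using eqS [OF A] eqS [OF B] AB by simp
qed

section \<open>Orthogonal complements, unitaries and supports\<close>

text \<open>The complement is relative to \<open>H\<close> and always closed, so for
  \<open>S\<close> inside \<open>H\<close> the double complement \<open>orth H (orth H S)\<close> is
  the closed span of \<open>S\<close>.\<close>

definition orth :: "'a::chilbert_space set \<Rightarrow> 'a set \<Rightarrow> 'a set"
  where "orth H S = {x\<in>H. \<forall>y\<in>S. cinner x y = 0}"

lemma orth_iff: "x \<in> orth H S \<longleftrightarrow> x \<in> H \<and> (\<forall>y\<in>S. cinner x y = 0)"
  by (simp add: orth_def)

lemma hilbert_space_orth: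
  assumes H: "hilbert_space H"
  shows "hilbert_space (orth H S)"
proof -
  have "closed (orth H S)"
    unfolding closed_sequential_limits
  proof (intro allI impI, elim conjE)
    fix f l assume f: "\<forall>n. f n \<in> orth H S" and l: "f \<longlonglongrightarrow> l"
    have "l \<in> H"
      using closed_sequentially [OF hilbert_spaceD(6) [OF H] _ l] f by (auto simp: orth_iff)
    moreover have "cinner l y = 0" if "y \<in> S" for y
      using LIMSEQ_unique [OF tendsto_cinner_left [OF l, of y]] f that by (simp add: orth_iff)
    ultimately show "l \<in> orth H S" by (simp add: orth_iff)
  qed
  then show ?thesis
    using H by (auto simp: hilbert_space_def csubspace_def orth_iff cinner_distribs cinner_scaleC_left)
qed

lemma unitary_opI:
  assumes "\<And>x. x \<in> H \<Longrightarrow> W x \<in> K" "\<And>x y. x \<in> H \<Longrightarrow> y \<in> H \<Longrightarrow> W (x + y) = W x + W y"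
    and "\<And>c x. x \<in> H \<Longrightarrow> W (c *\<^sub>C x) = c *\<^sub>C W x"
    and iso: "\<And>x y. x \<in> H \<Longrightarrow> y \<in> H \<Longrightarrow> cinner (W x) (W y) = cinner x y"
    and "\<And>y. y \<in> K \<Longrightarrow> \<exists>x\<in>H. W x = y"
  shows "unitary_op H K W"
proof -
  have "norm (W x) \<le> 1 * norm x" if "x \<in> H" for x
    using iso [OF that that] by (simp add: norm_eq_sqrt_inner inner_cinner)
  then have "bounded_op H K W"
    using assms by (intro bounded_opI [where B = 1]) auto
  then show ?thesis
    using assms by (auto simp: unitary_op_def) blast
qed

lemma unitary_opD:
  assumes "unitary_op H K W"
  shows "bounded_op H K W" "W ` H = K" "x \<in> H \<Longrightarrow> W x \<in> K"
    "x \<in> H \<Longrightarrow> y \<in> H \<Longrightarrow> cinner (W x) (W y) = cinner x y"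
  using assms by (auto simp: unitary_op_def)

lemma unitary_op_inj:
  assumes W: "unitary_op H K W" and H: "hilbert_space H"
  shows "inj_on W H"
proof (rule inj_onI)
  fix x y assume xy: "x \<in> H" "y \<in> H" "W x = W y"
  show "x = y"
  proof (rule cinner_eqI [OF H xy(1,2)])
    show "cinner z x = cinner z y" if "z \<in> H" for z
      using unitary_opD(4) [OF W that] xy by metis
  qed
qed

lemma unitary_op_inverse:
  assumes W: "unitary_op H K W" and H: "hilbert_space H"
  shows "unitary_op K H (inv_into H W)" "x \<in> H \<Longrightarrow> inv_into H W (W x) = x"
    "y \<in> K \<Longrightarrow> W (inv_into H W y) = y" "y \<in> K \<Longrightarrow> inv_into H W y \<in> H"
    "y \<in> K \<Longrightarrow> adj H W y = inv_into H W y"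
proof -
  note inj = unitary_op_inj [OF W H] and wD = unitary_opD [OF W] and hs = hilbert_spaceD [OF H]
  show l: "inv_into H W (W x) = x" if "x \<in> H" for x
    using inj that by simp
  show r: "W (inv_into H W y) = y" if "y \<in> K" for y
    using that wD(2) by (metis f_inv_into_f)
  show i: "inv_into H W y \<in> H" if "y \<in> K" for y
    using that wD(2) by (metis inv_into_into)
  show "adj H W y = inv_into H W y" if "y \<in> K"
    by (rule adj_eqI [OF H wD(1) i [OF that]]) (metis i r that wD(4))
  show "unitary_op K H (inv_into H W)"
  proof (rule unitary_opI [OF i])
    show "inv_into H W (x + y) = inv_into H W x + inv_into H W y" if "x \<in> K" "y \<in> K" for x y
      using l [of "inv_into H W x + inv_into H W y"] that
      by (simp add: bounded_opD(2) [OF wD(1)] i r hs)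
    show "inv_into H W (c *\<^sub>C x) = c *\<^sub>C inv_into H W x" if "x \<in> K" for c x
      using l [of "c *\<^sub>C inv_into H W x"] that
      by (simp add: bounded_opD(3) [OF wD(1)] i r hs)
    show "cinner (inv_into H W x) (inv_into H W y) = cinner x y" if "x \<in> K" "y \<in> K" for x y
      using wD(4) [OF i [OF that(1)] i [OF that(2)]] r that by simp
    show "\<exists>x\<in>K. inv_into H W x = y" if "y \<in> H" for y
      using l wD(3) that by blast
  qed
qed

lemma unitary_op_compose:
  assumes "unitary_op H K V" "unitary_op K L W"
  shows "unitary_op H L (\<lambda>x. W (V x))"
  using assms bounded_op_compose [of H K V L W] unfolding unitary_op_def
  by (auto simp: bounded_opD image_image [symmetric])

text \<open>The graph of the unitary is the double orthogonal complement of the set of pairs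
  \<open>(A x, X x)\<close>; that it is total is seen from the adjoint of the coordinate projections.\<close>

lemma unitary_from_dense_ranges:
  fixes H :: "'a::chilbert_space set" and K :: "'b::chilbert_space set"
  assumes H: "hilbert_space H" and K: "hilbert_space K"
    and A: "\<And>x. x \<in> D \<Longrightarrow> A x \<in> H" and X: "\<And>x. x \<in> D \<Longrightarrow> X x \<in> K"
    and AX: "\<And>x y. x \<in> D \<Longrightarrow> y \<in> D \<Longrightarrow> cinner (A x) (A y) = cinner (X x) (X y)"
    and denseA: "\<And>y. y \<in> H \<Longrightarrow> (\<And>x. x \<in> D \<Longrightarrow> cinner (A x) y = 0) \<Longrightarrow> y = 0"
    and denseX: "\<And>y. y \<in> K \<Longrightarrow> (\<And>x. x \<in> D \<Longrightarrow> cinner (X x) y = 0) \<Longrightarrow> y = 0"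
  shows "\<exists>V. unitary_op H K V \<and> (\<forall>x\<in>D. V (A x) = X x)"
proof -
  define P where "P = {w \<in> H \<times> K. \<forall>x\<in>D. cinner (A x, X x) w = 0}"
  define G where "G = orth (H \<times> K) P"
  have hG: "hilbert_space G"
    unfolding G_def by (intro hilbert_space_orth hilbert_space_Times H K)
  note gs = hilbert_spaceD [OF hG] and hs = hilbert_spaceD [OF H] and ks = hilbert_spaceD [OF K]
  have G0: "(A x, X x) \<in> G" if "x \<in> D" for x
    using that A X by (auto simp: G_def P_def orth_iff)
  have GD: "fst z \<in> H" "snd z \<in> K" if "z \<in> G" for z
    using that by (auto simp: G_def orth_iff)
  have G1: "cinner (fst z) (A x) = cinner (snd z) (X x)" if z: "z \<in> G" and x: "x \<in> D" for z x
  proof -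
    \<comment> \<open>Flipping the sign of the second component turns the equality of inner products
      \<open>AX\<close> into orthogonality. The same flip, applied next to elements of
      \<open>G\<close>, shows that all of \<open>G\<close> is the graph of an isometric
      relation.\<close>
    have "(A x, (-1) *\<^sub>C X x) \<in> P"
      using x A X AX ks by (auto simp: P_def cinner_prod_def cinner_scaleC_right)
    then show ?thesis
      using z by (auto simp: G_def orth_iff cinner_prod_def cinner_scaleC_right)
  qed
  have G2: "cinner (fst z) (fst w) = cinner (snd z) (snd w)" if z: "z \<in> G" and w: "w \<in> G" for z w
  proof -
    have "(fst w, (-1) *\<^sub>C snd w) \<in> P"
      using w GD ks arg_cong [OF G1 [OF w], of _ cnj]
      by (simp add: P_def cinner_prod_def cinner_scaleC_right flip: cinner_commute)
    then show ?thesis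
      using z by (auto simp: G_def orth_iff cinner_prod_def cinner_scaleC_right)
  qed
  have nf: "norm (fst z) \<le> norm z" "norm (snd z) \<le> norm z" for z :: "'a \<times> 'b"
    using norm_fst_le [of "fst z" "snd z"] norm_snd_le [of "snd z" "fst z"] by simp_all
  have bf: "bounded_op G H fst" and bs: "bounded_op G K snd"
    by (rule bounded_opI [where B = 1]; simp add: GD scaleC_prod_def nf)+
  have tot1: "\<exists>b. (y, b) \<in> G" if y: "y \<in> H" for y
  proof -
    define g where "g = adj G fst y"
    have g: "g \<in> G" and gz: "\<And>z. z \<in> G \<Longrightarrow> cinner z g = cinner (fst z) y"
      by (simp_all add: g_def adj_in [OF hG bf] cinner_adj [OF hG bf])
    \<comment> \<open>The factor 2: pairing (A x, X x) with \<open>g\<close> gives <A x, y> as a sum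
      of two terms, which are equal by \<open>G2\<close>; so <A x, y> is twice <A x, fst g>.\<close>
    have g2: "2 *\<^sub>R g \<in> G" by (rule gs(5) [OF g])
    have "y - fst (2 *\<^sub>R g) = 0"
    proof (rule denseA)
      show "y - fst (2 *\<^sub>R g) \<in> H" by (rule hs(3) [OF y GD(1) [OF g2]])
      show "cinner (A x) (y - fst (2 *\<^sub>R g)) = 0" if x: "x \<in> D" for x
        using gz [OF G0 [OF x]] G2 [OF G0 [OF x] g]
        by (simp add: cinner_prod_def cinner_diff_right cinner_scaleR_right)
    qed
    then show ?thesis using g2 by (metis eq_iff_diff_eq_0 prod.collapse)
  qed
  have tot2: "\<exists>a. (a, y) \<in> G" if y: "y \<in> K" for y
  proof -
    define g where "g = adj G snd y"
    have g: "g \<in> G" and gz: "\<And>z. z \<in> G \<Longrightarrow> cinner z g = cinner (snd z) y"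
      by (simp_all add: g_def adj_in [OF hG bs] cinner_adj [OF hG bs])
    have g2: "2 *\<^sub>R g \<in> G" by (rule gs(5) [OF g])
    have "y - snd (2 *\<^sub>R g) = 0"
    proof (rule denseX)
      show "y - snd (2 *\<^sub>R g) \<in> K" by (rule ks(3) [OF y GD(2) [OF g2]])
      show "cinner (X x) (y - snd (2 *\<^sub>R g)) = 0" if x: "x \<in> D" for x
        using gz [OF G0 [OF x]] G2 [OF G0 [OF x] g]
        by (simp add: cinner_prod_def cinner_diff_right cinner_scaleR_right)
    qed
    then show ?thesis using g2 by (metis eq_iff_diff_eq_0 prod.collapse)
  qed
  have uniq: "b = b'" if "(a, b) \<in> G" "(a, b') \<in> G" for a b b'
    using G2 [OF gs(3) [OF that] gs(3) [OF that]] by simp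
  define V where "V y = (SOME b. (y, b) \<in> G)" for y
  have V: "(y, V y) \<in> G" if "y \<in> H" for y
    unfolding V_def using tot1 [OF that] by (rule someI_ex)
  have "unitary_op H K V"
  proof (rule unitary_opI)
    show "V x \<in> K" if "x \<in> H" for x using GD(2) [OF V [OF that]] by simp
    show "V (x + y) = V x + V y" if "x \<in> H" "y \<in> H" for x y
      using uniq [OF V [OF hs(2) [OF that]], of "V x + V y"] gs(2) [OF V [OF that(1)] V [OF that(2)]]
      by simp
    show "V (c *\<^sub>C x) = c *\<^sub>C V x" if "x \<in> H" for c x
      using uniq [OF V [OF hs(4) [OF that]]] gs(4) [OF V [OF that], of c]
      by (simp add: scaleC_prod_def)
    show "cinner (V x) (V y) = cinner x y" if "x \<in> H" "y \<in> H" for x y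
      using G2 [OF V V] that by simp
    show "\<exists>x\<in>H. V x = y" if y: "y \<in> K" for y
    proof -
      obtain a where a: "(a, y) \<in> G" using tot2 [OF y] by blast
      have "a \<in> H" using GD(1) [OF a] by simp
      then show ?thesis using uniq [OF V a] by blast
    qed
  qed
  moreover have "V (A x) = X x" if "x \<in> D" for x
    using uniq [OF V [OF A [OF that]] G0 [OF that]] .
  ultimately show ?thesis by blast
qed

text \<open>A symmetric operator has its kernel as the orthogonal complement of its range: test with
  x = A y.\<close>

lemma positive_op_dense_range:
  assumes H: "hilbert_space H" and A: "positive_op H A"
    and inj: "\<And>x. x \<in> H \<Longrightarrow> A x = 0 \<Longrightarrow> x = 0"
    and y: "y \<in> H" "\<And>x. x \<in> H \<Longrightarrow> cinner (A x) y = 0"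
  shows "y = 0"
proof (rule inj [OF y(1)])
  have Ay: "A y \<in> H" using A y(1) bounded_opD(1) [of H H A y] by (simp add: positive_op_def)
  have "cinner (A y) (A y) = 0"
    using positive_op_symmetric [OF H A Ay y(1)] y(2) [OF Ay] by simp
  then show "A y = 0" by simp
qed

text \<open>If \<open>A x = 0\<close>, then the projection onto the orthogonal complement of \<open>x\<close> fixes the range
  of \<open>A\<close>.\<close>

lemma is_support_id_iff:
  assumes H: "hilbert_space H" and A: "positive_op H A"
  shows "is_support H A (\<lambda>x. x) \<longleftrightarrow> (\<forall>x\<in>H. A x = 0 \<longrightarrow> x = 0)"
proof
  note hs = hilbert_spaceD [OF H]
  have bA: "bounded_op H H A" using A by (simp add: positive_op_def)
  have proj_id: "projection_op H (\<lambda>x. x)"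
    using adj_eqI [OF H bounded_op_id [OF order_refl]]
    by (simp add: projection_op_def bounded_op_id)
  show "\<forall>x\<in>H. A x = 0 \<longrightarrow> x = 0" if supp: "is_support H A (\<lambda>x. x)"
  proof (intro ballI impI, rule ccontr)
    fix x assume x: "x \<in> H" "A x = 0" "x \<noteq> 0"
    define Q where "Q y = y - (cinner y x / cinner x x) *\<^sub>C x" for y
    have bQ: "bounded_op H H Q"
    proof (rule bounded_opI)
      \<comment> \<open>The constant is 1 + 2, the 2 stemming from the crude Cauchy-Schwarz bound
        \<open>norm_cinner_le\<close>.\<close>
      show "norm (Q y) \<le> 3 * norm y" for y
      proof -
        have "norm ((cinner y x / cinner x x) *\<^sub>C x) \<le> 2 * (norm y * norm x) / (norm x)\<^sup>2 * norm x"
          unfolding norm_scaleC norm_divide cinner_self norm_of_real abs_power2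
          by (intro mult_right_mono divide_right_mono) (auto intro: order_trans [OF norm_cinner_le])
        also have "\<dots> = 2 * norm y" using x by (simp add: power2_eq_square)
        finally show ?thesis
          using norm_triangle_ineq4 [of y "(cinner y x / cinner x x) *\<^sub>C x"] by (simp add: Q_def)
      qed
    qed (auto simp: Q_def hs x cinner_distribs cinner_scaleC_left scaleC_diff_right scaleC_add_left
        add_divide_distrib scaleC_scaleC)
    have "projection_op H Q"
      unfolding projection_op_def
    proof (intro conjI ballI bQ)
      show "Q (Q y) = Q y" for y
        using x by (simp add: Q_def cinner_distribs cinner_scaleC_left)
      show "adj H Q y = Q y" if y: "y \<in> H" for y
      proof (rule adj_eqI [OF H bQ bounded_opD(1) [OF bQ y]])
        show "cinner z (Q y) = cinner (Q z) y" for z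
          using cinner_commute [of x y] cinner_commute [of x x]
          by (simp add: Q_def cinner_distribs cinner_scaleC_left cinner_scaleC_right)
      qed
    qed
    moreover have "Q (A y) = A y" if "y \<in> H" for y
      using positive_op_symmetric [OF H A that x(1)] x by (simp add: Q_def)
    ultimately have "positive_op H (\<lambda>y. Q y - y)"
      using supp by (simp add: is_support_def)
    then have "cinner (Q x - x) x \<in> \<real>\<^sub>\<ge>\<^sub>0" using x by (simp add: positive_op_def)
    moreover have "cinner (Q x - x) x = - of_real ((norm x)\<^sup>2)"
      using x by (simp add: Q_def cinner_diff_left cinner_scaleC_left cinner_minus_left)
        (simp add: cinner_self)
    ultimately have "- (norm x)\<^sup>2 \<ge> 0"
      by (simp add: complex_nonneg_Reals_iff)
    then show False using x by simp
  qed
  show "is_support H A (\<lambda>x. x)" if inj: "\<forall>x\<in>H. A x = 0 \<longrightarrow> x = 0"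
    unfolding is_support_def
  proof (intro conjI allI impI proj_id ballI refl, elim conjE)
    fix Q assume Q: "projection_op H Q" and QA: "\<forall>x\<in>H. Q (A x) = A x"
    have bQ: "bounded_op H H Q" using Q by (simp add: projection_op_def)
    have Q_id: "Q x = x" if x: "x \<in> H" for x
    proof -
      have Qx: "Q x \<in> H" using bQ x by (simp add: bounded_opD)
      \<comment> \<open>\<open>Q\<close> is its own adjoint and fixes the range of \<open>A\<close>,
        so \<open>Q x - x\<close> is orthogonal to that range, which is dense.\<close>
      have "Q x - x = 0"
      proof (rule positive_op_dense_range [OF H A])
        show "cinner (A y) (Q x - x) = 0" if y: "y \<in> H" for y
        proof -
          have Ay: "A y \<in> H" using bA y by (simp add: bounded_opD)
          have "cinner (A y) (Q x) = cinner (A y) (adj H Q x)"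
            using Q x by (simp add: projection_op_def)
          also have "\<dots> = cinner (A y) x"
            using QA y by (simp add: cinner_adj [OF H bQ Ay])
          finally show ?thesis by (simp add: cinner_diff_right)
        qed
      qed (use inj x Qx hs in auto)
      then show ?thesis by simp
    qed
    then show "positive_op H (\<lambda>x. Q x - x)"
      using hs by (auto simp: positive_op_def intro!: bounded_opI [where B = 0])
  qed
qed

section \<open>Weighted shifts\<close>

lift_definition l2_single :: "nat \<Rightarrow> 'a \<Rightarrow> 'a::real_normed_vector l2seq"
  is "\<lambda>k x n. if n = k then x else 0"
proof -
  fix k and x :: 'a
  show "summable (\<lambda>n. (norm (if n = k then x else 0))\<^sup>2)"
    by (rule summable_finite [of "{k}"]) auto
qed

lemma cinner_l2_single: "cinner (l2_single k x) \<xi> = cinner x (l2_nth \<xi> k)"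
proof -
  have "cinner (l2_single k x) \<xi> = (\<Sum>n\<in>{k}. cinner (l2_nth (l2_single k x) n) (l2_nth \<xi> n))"
    unfolding cinner_l2seq_def by (rule suminf_finite) (auto simp: l2_single.rep_eq)
  then show ?thesis by (simp add: l2_single.rep_eq)
qed

lemma l2_single_add: "l2_single k (x + y) = l2_single k x + l2_single k y"
  by (rule l2_eqI) (simp add: l2_single.rep_eq plus_l2seq.rep_eq)

lemma l2_single_scaleC: "l2_single k (c *\<^sub>C x) = c *\<^sub>C l2_single k (x::'a::complex_inner)"
  by (rule l2_eqI) (simp add: l2_single.rep_eq scaleC_l2seq.rep_eq)

lemma l2_single_in: "hilbert_space H \<Longrightarrow> x \<in> H \<Longrightarrow> l2_single k x \<in> l2_space H"
  by (simp add: l2_space_def l2_single.rep_eq hilbert_spaceD)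

lemma l2_nth_wshift [simp]:
  "l2_nth (wshift A \<xi>) 0 = 0" "l2_nth (wshift A \<xi>) (Suc 0) = A (l2_nth \<xi> 0)"
  "l2_nth (wshift A \<xi>) (Suc (Suc n)) = l2_nth \<xi> (Suc n)"
  by (simp_all add: wshift.rep_eq)

lemma wshift_l2_single: "A 0 = 0 \<Longrightarrow> wshift A (l2_single 0 x) = l2_single (Suc 0) (A x)"
  "A 0 = 0 \<Longrightarrow> wshift A (l2_single (Suc n) x) = l2_single (Suc (Suc n)) x"
  by (rule l2_eqI; simp add: wshift.rep_eq l2_single.rep_eq split: nat.split)+

lemma wshift_zero: "A 0 = 0 \<Longrightarrow> wshift A 0 = 0"
  by (rule l2_eqI) (simp add: wshift.rep_eq zero_l2seq.rep_eq split: nat.split)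

lemma wshift_in: "bounded_op H H A \<Longrightarrow> hilbert_space H \<Longrightarrow> \<xi> \<in> l2_space H \<Longrightarrow> wshift A \<xi> \<in> l2_space H"
  by (auto simp: l2_space_def wshift.rep_eq bounded_opD hilbert_spaceD split: nat.split)

text \<open>Each application pushes the entries up by one. Hence a vector in the ranges of all
  powers has no component in the shift summand.\<close>

lemma wshift_funpow_nth:
  assumes "A 0 = 0" "k < n"
  shows "l2_nth ((wshift A ^^ n) \<xi>) k = 0"
  using assms(2)
proof (induction n arbitrary: k)
  case (Suc n)
  then show ?case
    using assms(1) by (auto simp: wshift.rep_eq split: nat.split)
qed simp

section \<open>Uniqueness\<close>

definition op_ker :: "'a::chilbert_space set \<Rightarrow> ('a \<Rightarrow> 'a) \<Rightarrow> 'a set"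
  where "op_ker H X = {x\<in>H. X x = 0}"

text \<open>Since it refers to \<open>X\<close> alone, this space serves twice: as the choice of
  \<open>H1\<close> in the existence proof, and as the common target that identifies the first
  spaces of two decompositions.\<close>

definition op_initial :: "'a::chilbert_space set \<Rightarrow> ('a \<Rightarrow> 'a) \<Rightarrow> 'a set"
  where "op_initial H X = orth H (X ` H \<union> op_ker H X)"

definition op_core :: "'a::chilbert_space set \<Rightarrow> ('a \<Rightarrow> 'a) \<Rightarrow> 'a set"
  where "op_core H X = {x\<in>H. \<forall>n. \<exists>z\<in>H. (X ^^ n) z = x}"

section \<open>Computations in the coordinates of a given decomposition\<close>

locale decomposed =
  fixes H :: "'a::chilbert_space set" and X :: "'a \<Rightarrow> 'a"
    and H1 :: "'b::chilbert_space set" and H2 :: "'c::chilbert_space set"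
    and H3 :: "'d::chilbert_space set" and A U
  assumes H: "hilbert_space H" and bX: "bounded_op H H X"
    and dec: "decomposition H X H1 H2 H3 A U"
begin

abbreviation "L \<equiv> l2_space H1 \<times> H2 \<times> H3"
abbreviation "Y \<equiv> map_prod (wshift A) (map_prod U (\<lambda>_::'d. 0::'d))"

lemma H1: "hilbert_space H1" and H2: "hilbert_space H2" and H3: "hilbert_space H3"
  and posA: "positive_op H1 A" and bA: "bounded_op H1 H1 A" and unU: "unitary_op H2 H2 U"
  and bU: "bounded_op H2 H2 U"
  using dec by (auto simp: decomposition_def positive_op_def unitary_op_def)

lemma injA: "x \<in> H1 \<Longrightarrow> A x = 0 \<Longrightarrow> x = 0"
  using dec is_support_id_iff [OF H1 posA] by (simp add: decomposition_def)

lemma hL: "hilbert_space L"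
  by (intro hilbert_space_Times hilbert_space_l2_space H1 H2 H3)

lemma zeros [simp]: "A 0 = 0" "U 0 = 0" "0 \<in> H1" "0 \<in> H2" "0 \<in> H3" "0 \<in> l2_space H1"
  using bounded_op_zero [OF bA H1] bounded_op_zero [OF bU H2]
  by (simp_all add: hilbert_spaceD H1 H2 H3 hilbert_space_l2_space)

lemma injU: "x \<in> H2 \<Longrightarrow> U x = 0 \<Longrightarrow> x = 0"
  using unitary_op_inj [OF unU H2] by (auto simp: inj_on_def)

lemma surjU:
  assumes "u \<in> H2"
  obtains v where "v \<in> H2" "U v = u"
proof -
  have "u \<in> U ` H2" using assms unitary_opD(2) [OF unU] by simp
  then show thesis using that by (auto elim!: imageE)
qed

text \<open>The inverse of a chosen intertwining unitary: vectors of \<open>H\<close> are then given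
  by their coordinates, on which \<open>X\<close> acts as \<open>Y\<close>.\<close>

definition Psi where "Psi = inv_into H (SOME \<Phi>. unitary_op H L \<Phi> \<and> (\<forall>x\<in>H. \<Phi> (X x) = Y (\<Phi> x)))"

lemma Y_in: "p \<in> L \<Longrightarrow> Y p \<in> L"
  using bounded_opD(1) [OF bU] hilbert_spaceD(1) [OF H3] wshift_in [OF bA H1] by auto

lemma unPsi: "unitary_op L H Psi" and X_Psi: "p \<in> L \<Longrightarrow> X (Psi p) = Psi (Y p)"
proof -
  define \<Phi> where "\<Phi> = (SOME \<Phi>. unitary_op H L \<Phi> \<and> (\<forall>x\<in>H. \<Phi> (X x) = Y (\<Phi> x)))"
  have \<Phi>: "unitary_op H L \<Phi>" "\<And>x. x \<in> H \<Longrightarrow> \<Phi> (X x) = Y (\<Phi> x)"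
    using someI_ex [of "\<lambda>\<Phi>. unitary_op H L \<Phi> \<and> (\<forall>x\<in>H. \<Phi> (X x) = Y (\<Phi> x))"] dec
    unfolding decomposition_def \<Phi>_def [symmetric] by blast+
  note inv = unitary_op_inverse [OF \<Phi>(1) H]
  have Psi: "Psi = inv_into H \<Phi>" by (simp add: Psi_def \<Phi>_def)
  show "unitary_op L H Psi" unfolding Psi by (rule inv(1))
  show "X (Psi p) = Psi (Y p)" if p: "p \<in> L"
    using inv(2) [OF bounded_opD(1) [OF bX inv(4) [OF p]]] \<Phi>(2) [OF inv(4) [OF p]] inv(3) [OF p]
    by (simp add: Psi)
qed

lemma Psi_in: "p \<in> L \<Longrightarrow> Psi p \<in> H"
  and cinner_Psi: "p \<in> L \<Longrightarrow> q \<in> L \<Longrightarrow> cinner (Psi p) (Psi q) = cinner p q"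
  using unitary_opD [OF unPsi] by auto

lemma Psi_cases:
  assumes "x \<in> H"
  obtains \<xi> u h where "x = Psi (\<xi>, u, h)" "\<xi> \<in> l2_space H1" "u \<in> H2" "h \<in> H3"
proof -
  have "x \<in> Psi ` L" using assms unitary_opD(2) [OF unPsi] by simp
  then show thesis using that by auto
qed

lemma Psi_inj: "p \<in> L \<Longrightarrow> q \<in> L \<Longrightarrow> Psi p = Psi q \<Longrightarrow> p = q"
  using unitary_op_inj [OF unPsi hL] by (auto simp: inj_on_def)

lemma Psi_0: "Psi 0 = 0"
  using bounded_op_zero [OF unitary_opD(1) [OF unPsi] hL] .

text \<open>The shift inherits injectivity from \<open>A\<close>: the entries of its value are A
  applied to entry 0, followed by all later entries unchanged. \<open>U\<close> is injective as a
  unitary.\<close>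

lemma ker_iff:
  assumes "\<xi> \<in> l2_space H1" "u \<in> H2" "h \<in> H3"
  shows "X (Psi (\<xi>, u, h)) = 0 \<longleftrightarrow> \<xi> = 0 \<and> u = 0"
proof
  have p: "(\<xi>, u, h) \<in> L" using assms by simp
  show "X (Psi (\<xi>, u, h)) = 0" if "\<xi> = 0 \<and> u = 0"
    using X_Psi [OF p] that Psi_0 by (simp add: wshift_zero zero_prod_def)
  assume "X (Psi (\<xi>, u, h)) = 0"
  then have "Psi (Y (\<xi>, u, h)) = Psi 0" using X_Psi [OF p] Psi_0 by simp
  then have "Y (\<xi>, u, h) = 0"
    by (rule Psi_inj [OF Y_in [OF p] hilbert_spaceD(1) [OF hL]])
  then have w: "wshift A \<xi> = 0" and u: "U u = 0" by (simp_all add: zero_prod_def)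
  have "A (l2_nth \<xi> 0) = 0" and S: "l2_nth \<xi> (Suc n) = 0" for n
    using arg_cong [OF w, of "\<lambda>\<xi>. l2_nth \<xi> (Suc 0)"] arg_cong [OF w, of "\<lambda>\<xi>. l2_nth \<xi> (Suc (Suc n))"]
    by (simp_all add: zero_l2seq.rep_eq)
  then have "l2_nth \<xi> 0 = 0" using injA assms(1) by (simp add: l2_space_def)
  have "l2_nth \<xi> n = l2_nth 0 n" for n
    using S \<open>l2_nth \<xi> 0 = 0\<close> by (cases n) (simp_all add: zero_l2seq.rep_eq)
  then have "\<xi> = 0" by (rule l2_eqI)
  then show "\<xi> = 0 \<and> u = 0" using injU u assms by simp
qed

lemma unitary_op_ker: "unitary_op H3 (op_ker H X) (\<lambda>h. Psi (0, 0, h))"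
proof (rule unitary_opI)
  show "Psi (0, 0, h) \<in> op_ker H X" if "h \<in> H3" for h
    using that ker_iff [of 0 0 h] Psi_in by (simp add: op_ker_def)
  show "Psi (0, 0, x + y) = Psi (0, 0, x) + Psi (0, 0, y)" if "x \<in> H3" "y \<in> H3" for x y
    using bounded_opD(2) [OF unitary_opD(1) [OF unPsi], of "(0, 0, x)" "(0, 0, y)"] that by simp
  show "Psi (0, 0, c *\<^sub>C x) = c *\<^sub>C Psi (0, 0, x)" if "x \<in> H3" for c x
    using bounded_opD(3) [OF unitary_opD(1) [OF unPsi], of "(0, 0, x)" c] that
    by (simp add: scaleC_prod_def)
  show "cinner (Psi (0, 0, x)) (Psi (0, 0, y)) = cinner x y" if "x \<in> H3" "y \<in> H3" for x y
    using that by (simp add: cinner_Psi cinner_prod_def)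
  show "\<exists>x\<in>H3. Psi (0, 0, x) = y" if y: "y \<in> op_ker H X" for y
  proof -
    have "y \<in> H" "X y = 0" using y by (auto simp: op_ker_def)
    from Psi_cases [OF this(1)] obtain \<xi> u h
      where p: "y = Psi (\<xi>, u, h)" "\<xi> \<in> l2_space H1" "u \<in> H2" "h \<in> H3" .
    with \<open>X y = 0\<close> ker_iff [OF p(2-4)] show ?thesis by auto
  qed
qed

lemma X_Psi_single:
  assumes "e \<in> H1"
  shows "X (Psi (l2_single 0 e, 0, 0)) = Psi (l2_single (Suc 0) (A e), 0, 0)"
    "X (Psi (l2_single (Suc n) e, 0, 0)) = Psi (l2_single (Suc (Suc n)) e, 0, 0)"
  using assms by (simp_all add: X_Psi l2_single_in H1 wshift_l2_single)

text \<open>Surjectivity is the substantial part. Orthogonality to the kernel removes the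
  \<open>H3\<close> component; orthogonality to the range removes the \<open>H2\<close> component,
  as \<open>U\<close> is onto, and all entries of the sequence except entry 0.\<close>

lemma unitary_op_initial: "unitary_op H1 (op_initial H X) (\<lambda>e. Psi (l2_single 0 e, 0, 0))"
proof (rule unitary_opI)
  show "Psi (l2_single 0 e, 0, 0) \<in> op_initial H X" if e: "e \<in> H1" for e
    unfolding op_initial_def orth_iff
  proof (intro conjI ballI)
    show "Psi (l2_single 0 e, 0, 0) \<in> H"
      using e by (simp add: Psi_in l2_single_in H1)
    fix y assume y: "y \<in> X ` H \<union> op_ker H X"
    then consider x where "x \<in> H" "y = X x" | "y \<in> H" "X y = 0" by (auto simp: op_ker_def)
    then show "cinner (Psi (l2_single 0 e, 0, 0)) y = 0"
    proof cases
      case 1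
      obtain \<xi> u h where p: "x = Psi (\<xi>, u, h)" "\<xi> \<in> l2_space H1" "u \<in> H2" "h \<in> H3"
        using Psi_cases [OF 1(1)] .
      then have "(\<xi>, u, h) \<in> L" by simp
      from X_Psi [OF this] Y_in [OF this] show ?thesis
        using e 1(2) p(1)
        by (simp add: cinner_Psi l2_single_in H1 cinner_prod_def cinner_l2_single)
    next
      case 2
      obtain \<xi> u h where p: "y = Psi (\<xi>, u, h)" "\<xi> \<in> l2_space H1" "u \<in> H2" "h \<in> H3"
        using Psi_cases [OF 2(1)] .
      then show ?thesis
        using e ker_iff [OF p(2-4)] 2(2)
        by (simp add: cinner_Psi l2_single_in H1 cinner_prod_def)
    qed
  qed
  show "Psi (l2_single 0 (x + y), 0, 0) = Psi (l2_single 0 x, 0, 0) + Psi (l2_single 0 y, 0, 0)"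
    if "x \<in> H1" "y \<in> H1" for x y
    using bounded_opD(2) [OF unitary_opD(1) [OF unPsi], of "(l2_single 0 x, 0, 0)" "(l2_single 0 y, 0, 0)"]
      that by (simp add: l2_single_add l2_single_in H1)
  show "Psi (l2_single 0 (c *\<^sub>C x), 0, 0) = c *\<^sub>C Psi (l2_single 0 x, 0, 0)" if "x \<in> H1" for c x
    using bounded_opD(3) [OF unitary_opD(1) [OF unPsi], of "(l2_single 0 x, 0, 0)" c] that
    by (simp add: scaleC_prod_def l2_single_scaleC l2_single_in H1)
  show "cinner (Psi (l2_single 0 x, 0, 0)) (Psi (l2_single 0 y, 0, 0)) = cinner x y"
    if "x \<in> H1" "y \<in> H1" for x y
    using that by (simp add: cinner_Psi l2_single_in H1 cinner_prod_def cinner_l2_single l2_single.rep_eq)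
  show "\<exists>x\<in>H1. Psi (l2_single 0 x, 0, 0) = y" if y: "y \<in> op_initial H X" for y
  proof -
    have yH: "y \<in> H" and ran: "\<And>x. x \<in> H \<Longrightarrow> cinner y (X x) = 0"
      and ker: "\<And>x. x \<in> H \<Longrightarrow> X x = 0 \<Longrightarrow> cinner y x = 0"
      using y by (auto simp: op_initial_def orth_iff op_ker_def)
    obtain \<xi> u h where p: "y = Psi (\<xi>, u, h)" "\<xi> \<in> l2_space H1" "u \<in> H2" "h \<in> H3"
      using Psi_cases [OF yH] .
    have pL: "(\<xi>, u, h) \<in> L" using p by simp
    have \<xi>n: "l2_nth \<xi> n \<in> H1" for n using p(2) by (simp add: l2_space_def)
    \<comment> \<open>Whenever a sequence concentrated in one entry is a value of \<open>X\<close>,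
      orthogonality to the range tests that entry of \<open>\<xi>\<close>.\<close>
    have sing: "cinner (l2_single n e) \<xi> = 0" if "n = Suc m" "e \<in> H1"
      "X (Psi (l2_single m e', 0, 0)) = Psi (l2_single n e, 0, 0)" "e' \<in> H1" for n m e e'
    proof -
      have "cinner y (X (Psi (l2_single m e', 0, 0))) = 0"
        using that by (intro ran Psi_in) (simp add: l2_single_in H1)
      then have "cinner (\<xi>, u, h) (l2_single n e, 0, 0) = 0"
        using that pL by (simp add: p(1) cinner_Psi l2_single_in H1)
      then show ?thesis by (simp add: cinner_prod_def cinner_eq_zero_swap [of \<xi>])
    qed
    have "h = 0"
    proof -
      have hL: "(0, 0, h) \<in> L" using p(4) by simp
      have "X (Psi (0, 0, h)) = 0" using ker_iff [OF zeros(6,4) p(4)] by simp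
      then have "cinner (Psi (\<xi>, u, h)) (Psi (0, 0, h)) = 0"
        using ker [OF Psi_in [OF hL]] p(1) by simp
      then show ?thesis by (simp only: cinner_Psi [OF pL hL]) (simp add: cinner_prod_def)
    qed
    moreover have "u = 0"
    proof -
      obtain v where v: "v \<in> H2" "U v = u" by (rule surjU [OF p(3)])
      have vL: "(0, v, 0) \<in> L" and uL: "(0, u, 0) \<in> L" using v(1) p(3) by simp_all
      have "X (Psi (0, v, 0)) = Psi (0, u, 0)" using v by (simp add: X_Psi wshift_zero)
      then have "cinner (Psi (\<xi>, u, h)) (Psi (0, u, 0)) = 0"
        using ran [OF Psi_in [OF vL]] p(1) by simp
      then show ?thesis by (simp only: cinner_Psi [OF pL uL]) (simp add: cinner_prod_def)
    qed
    moreover have S: "l2_nth \<xi> (Suc n) = 0" for n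
    proof (cases n)
      case 0
      \<comment> \<open>Entry 1 is reached only through \<open>A\<close>, so density of the range of
        \<open>A\<close> is needed here; later entries can be tested against themselves.\<close>
      have "l2_nth \<xi> (Suc 0) = 0"
      proof (rule positive_op_dense_range [OF H1 posA injA \<xi>n])
        show "cinner (A x) (l2_nth \<xi> (Suc 0)) = 0" if "x \<in> H1" for x
          using sing [OF refl bounded_opD(1) [OF bA that] X_Psi_single(1) [OF that] that]
          by (simp add: cinner_l2_single)
      qed
      then show ?thesis using 0 by simp
    next
      case (Suc m)
      show ?thesis
        using sing [OF refl \<xi>n X_Psi_single(2) [OF \<xi>n] \<xi>n, of m "Suc n"] Suc
        by (simp add: cinner_l2_single)
    qed
    moreover have "l2_single 0 (l2_nth \<xi> 0) = \<xi>"
    proof (rule l2_eqI)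
      show "l2_nth (l2_single 0 (l2_nth \<xi> 0)) n = l2_nth \<xi> n" for n
        using S by (cases n) (simp_all add: l2_single.rep_eq)
    qed
    ultimately show ?thesis
      using p(1) \<xi>n by (intro bexI [of _ "l2_nth \<xi> 0"]) simp_all
  qed
qed

text \<open>This is how \<open>X\<close> determines \<open>A\<close>: it fixes the form of the
  square of \<open>A\<close>, and positive roots are unique.\<close>

lemma cinner_X_initial:
  assumes "e \<in> H1" "f \<in> H1"
  shows "cinner (X (Psi (l2_single 0 e, 0, 0))) (X (Psi (l2_single 0 f, 0, 0))) = cinner (A e) (A f)"
  using assms bounded_opD(1) [OF bA]
  by (simp add: X_Psi_single cinner_Psi l2_single_in H1 cinner_prod_def cinner_l2_single l2_single.rep_eq)

lemma X_core: "u \<in> H2 \<Longrightarrow> X (Psi (0, u, 0)) = Psi (0, U u, 0)"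
  by (simp add: X_Psi wshift_zero)

lemma funpow_X_Psi: "p \<in> L \<Longrightarrow> (Y ^^ n) p \<in> L \<and> (X ^^ n) (Psi p) = Psi ((Y ^^ n) p)"
proof (induction n)
  case (Suc n)
  then have i: "(Y ^^ n) p \<in> L" and e: "(X ^^ n) (Psi p) = Psi ((Y ^^ n) p)" by blast+
  show ?case using Y_in [OF i] X_Psi [OF i] e by simp
qed simp

lemma funpow_Y: "(Y ^^ n) p = ((wshift A ^^ n) (fst p), (U ^^ n) (fst (snd p)), if n = 0 then snd (snd p) else 0)"
  by (induction n) (auto simp: map_prod_def split_beta)

lemma unitary_op_core: "unitary_op H2 (op_core H X) (\<lambda>u. Psi (0, u, 0))"
proof (rule unitary_opI)
  show "Psi (0, u, 0) \<in> op_core H X" if u: "u \<in> H2" for u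
  proof -
    have "\<exists>v\<in>H2. (X ^^ n) (Psi (0, v, 0)) = Psi (0, u, 0)" for n
      using u
    proof (induction n arbitrary: u)
      case (Suc n)
      obtain w where w: "w \<in> H2" "U w = u" by (rule surjU [OF Suc.prems])
      obtain v where "v \<in> H2" "(X ^^ n) (Psi (0, v, 0)) = Psi (0, w, 0)"
        using Suc.IH [OF w(1)] by blast
      then show ?case using X_core [OF w(1)] w(2) by (intro bexI [of _ v]) simp_all
    qed auto
    then show ?thesis using u Psi_in by (auto simp: op_core_def) (metis Psi_in SigmaI zeros(5,6))
  qed
  show "Psi (0, x + y, 0) = Psi (0, x, 0) + Psi (0, y, 0)" if "x \<in> H2" "y \<in> H2" for x y
    using bounded_opD(2) [OF unitary_opD(1) [OF unPsi], of "(0, x, 0)" "(0, y, 0)"] that by simp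
  show "Psi (0, c *\<^sub>C x, 0) = c *\<^sub>C Psi (0, x, 0)" if "x \<in> H2" for c x
    using bounded_opD(3) [OF unitary_opD(1) [OF unPsi], of "(0, x, 0)" c] that
    by (simp add: scaleC_prod_def)
  show "cinner (Psi (0, x, 0)) (Psi (0, y, 0)) = cinner x y" if "x \<in> H2" "y \<in> H2" for x y
    using that by (simp add: cinner_Psi cinner_prod_def)
  show "\<exists>x\<in>H2. Psi (0, x, 0) = y" if y: "y \<in> op_core H X" for y
  proof -
    have yH: "y \<in> H" and core: "\<And>n. \<exists>z\<in>H. (X ^^ n) z = y" using y by (auto simp: op_core_def)
    obtain \<xi> u h where p: "y = Psi (\<xi>, u, h)" "\<xi> \<in> l2_space H1" "u \<in> H2" "h \<in> H3"
      using Psi_cases [OF yH] .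
    have "l2_nth \<xi> n = 0 \<and> h = 0" for n
    proof -
      \<comment> \<open>The power n + 1 clears entries 0 to n, and being at least 1 it also clears
        the \<open>H3\<close> component.\<close>
      obtain z where z: "z \<in> H" "(X ^^ Suc n) z = y" using core by blast
      obtain q where q: "q \<in> L" "z = Psi q" using Psi_cases [OF z(1)] by (metis SigmaI)
      have "(\<xi>, u, h) = (Y ^^ Suc n) q"
        using funpow_X_Psi [OF q(1), of "Suc n"] z(2) q(2) p
        by (intro Psi_inj) auto
      then have "\<xi> = (wshift A ^^ Suc n) (fst q)" "h = 0" unfolding funpow_Y by simp_all
      then show ?thesis using wshift_funpow_nth [of A n "Suc n" "fst q"] by simp
    qed
    then have "\<xi> = 0" "h = 0" by (auto intro!: l2_eqI simp: zero_l2seq.rep_eq)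
    with p show ?thesis by auto
  qed
qed

text \<open>If \<open>X\<close> is normal, a vector v of the zeroth copy satisfies X* v = 0, hence
  X*X v = 0 and X v = 0; but v is orthogonal to the kernel. Conversely, for trivial
  \<open>H1\<close> the operator is U + 0, whose adjoint is the inverse of U on \<open>H2\<close>
  and 0 on \<open>H3\<close>.\<close>

lemma scaling_element_iff:
  assumes X: "\<forall>x\<in>H. adj H X (X (X x)) = X x"
  shows "scaling_element H X \<longleftrightarrow> H1 \<noteq> {0}"
proof -
  have "H1 = {0}" if normal: "\<forall>x\<in>H. adj H X (X x) = X (adj H X x)"
  proof -
    have "e = 0" if e: "e \<in> H1" for e
    proof -
      define v where "v = Psi (l2_single 0 e, 0, 0)"
      have v: "v \<in> op_initial H X"
        using unitary_opD(3) [OF unitary_op_initial e] by (simp add: v_def)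
      then have vH: "v \<in> H" and ran: "\<And>x. x \<in> H \<Longrightarrow> cinner v (X x) = 0"
        and ker: "\<And>x. x \<in> H \<Longrightarrow> X x = 0 \<Longrightarrow> cinner v x = 0"
        by (auto simp: op_initial_def orth_iff op_ker_def)
      have "adj H X v = 0"
        using ran by (intro adj_eqI [OF H bX])
          (auto simp: hilbert_spaceD [OF H] cinner_eq_zero_swap [of "X _"])
      then have "adj H X (X v) = 0" using normal vH bounded_op_zero [OF bX H] by simp
      then have "X v = 0" using cinner_adj [OF H bX vH, of "X v"] by simp
      then have "v = 0" using ker [OF vH] by simp
      then show "e = 0"
        using unitary_opD(4) [OF unitary_op_initial e e] by (simp add: v_def)
    qed
    then show ?thesis using zeros by blast
  qed
  moreover have "adj H X (X x) = X (adj H X x)" if z: "H1 = {0}" and x: "x \<in> H" for x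
  proof -
    have zero: "\<xi> = 0" if "\<xi> \<in> l2_space H1" for \<xi>
      using that z by (intro l2_eqI) (simp add: l2_space_def zero_l2seq.rep_eq)
    obtain u h where p: "x = Psi (0, u, h)" "u \<in> H2" "h \<in> H3"
      using Psi_cases [OF x] zero by metis
    obtain v where v: "v \<in> H2" "U v = u" by (rule surjU [OF p(2)])
    have Uu: "U u \<in> H2" using unitary_opD(3) [OF unU p(2)] .
    have X0: "X (Psi (0, w, k)) = Psi (0, U w, 0)" if "w \<in> H2" "k \<in> H3" for w k
      using that by (simp add: X_Psi wshift_zero)
    have "adj H X (X x) = Psi (0, u, 0)"
    proof (rule adj_eqI [OF H bX])
      fix z assume "z \<in> H"
      then obtain w k where w: "z = Psi (0, w, k)" "w \<in> H2" "k \<in> H3"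
        using Psi_cases zero by metis
      then show "cinner z (Psi (0, u, 0)) = cinner (X z) (X x)"
        using p Uu unitary_opD(3,4) [OF unU]
        by (simp add: X0 cinner_Psi cinner_prod_def)
    qed (simp add: Psi_in p)
    moreover have "adj H X x = Psi (0, v, 0)"
    proof (rule adj_eqI [OF H bX])
      fix z assume "z \<in> H"
      then obtain w k where w: "z = Psi (0, w, k)" "w \<in> H2" "k \<in> H3"
        using Psi_cases zero by metis
      then show "cinner z (Psi (0, v, 0)) = cinner (X z) x"
        using p v unitary_opD(3) [OF unU] unitary_opD(4) [OF unU w(2) v(1)]
        by (simp add: X0 cinner_Psi cinner_prod_def)
    qed (simp add: Psi_in v)
    ultimately show ?thesis using v by (simp add: X0)
  qed
  ultimately have "(\<forall>x\<in>H. adj H X (X x) = X (adj H X x)) \<longleftrightarrow> H1 = {0}"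
    by (intro iffI ballI) simp_all
  then show ?thesis using bX X by (simp add: scaling_element_def)
qed

end

text \<open>Both decompositions identify their spaces with the same subspaces of \<open>H\<close>:
  initial space, core and kernel of \<open>X\<close>. The required unitaries are the changes of
  identification, and U and U' are both the restriction of \<open>X\<close> to the core.\<close>

lemma decomposition_unique:
  assumes H: "hilbert_space H" and X: "bounded_op H H X"
    and d: "decomposition H X H1 H2 H3 A U" and d': "decomposition H X H1' H2' H3' A' U'"
  shows "\<exists>W1 W2 W3.
    unitary_op H1 H1' W1 \<and> unitary_op H2 H2' W2 \<and> unitary_op H3 H3' W3 \<and>
    (\<forall>y\<in>H1'. W1 (A (adj H1 W1 y)) = A' y) \<and> (\<forall>y\<in>H2'. W2 (U (adj H2 W2 y)) = U' y)"
proof -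
  interpret D: decomposed H X H1 H2 H3 A U by (rule decomposed.intro) (fact H X d)+
  interpret D': decomposed H X H1' H2' H3' A' U' by (rule decomposed.intro) (fact H X d')+
  define j1 where "j1 e = D.Psi (l2_single 0 e, 0, 0)" for e
  define j2 where "j2 u = D.Psi (0, u, 0)" for u
  define j3 where "j3 h = D.Psi (0, 0, h)" for h
  define j1' where "j1' e = D'.Psi (l2_single 0 e, 0, 0)" for e
  define j2' where "j2' u = D'.Psi (0, u, 0)" for u
  define j3' where "j3' h = D'.Psi (0, 0, h)" for h
  note j = D.unitary_op_initial [folded j1_def] D.unitary_op_core [folded j2_def]
    D.unitary_op_ker [folded j3_def]
  note j' = D'.unitary_op_initial [folded j1'_def] D'.unitary_op_core [folded j2'_def]
    D'.unitary_op_ker [folded j3'_def]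
  note i1' = unitary_op_inverse [OF j'(1) D'.H1] and i2' = unitary_op_inverse [OF j'(2) D'.H2]
    and i3' = unitary_op_inverse [OF j'(3) D'.H3]
  define W1 where "W1 e = inv_into H1' j1' (j1 e)" for e
  define W2 where "W2 u = inv_into H2' j2' (j2 u)" for u
  define W3 where "W3 h = inv_into H3' j3' (j3 h)" for h
  have W1: "unitary_op H1 H1' W1" and W2: "unitary_op H2 H2' W2" and W3: "unitary_op H3 H3' W3"
    unfolding W1_def W2_def W3_def
    by (rule unitary_op_compose [OF j(1) i1'(1)] unitary_op_compose [OF j(2) i2'(1)]
        unitary_op_compose [OF j(3) i3'(1)])+
  have j1W: "j1' (W1 e) = j1 e" if "e \<in> H1" for e
    using i1'(3) [OF unitary_opD(3) [OF j(1) that]] by (simp add: W1_def)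
  have j2W: "j2' (W2 u) = j2 u" if "u \<in> H2" for u
    using i2'(3) [OF unitary_opD(3) [OF j(2) that]] by (simp add: W2_def)
  note k1 = unitary_op_inverse [OF W1 D.H1] and k2 = unitary_op_inverse [OF W2 D.H2]
  have "W2 (U (adj H2 W2 y)) = U' y" if y: "y \<in> H2'" for y
  proof -
    let ?u = "inv_into H2 W2 y"
    have u: "?u \<in> H2" "W2 ?u = y" using k2(3,4) [OF y] by auto
    have Uu: "U ?u \<in> H2" using unitary_opD(3) [OF D.unU u(1)] .
    have "j2' (W2 (U ?u)) = X (j2 ?u)" using u(1) by (simp add: j2W Uu j2_def D.X_core)
    also have "\<dots> = X (j2' y)" using j2W [OF u(1)] u(2) by simp
    also have "\<dots> = j2' (U' y)" using y by (simp add: j2'_def D'.X_core)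
    finally have "inv_into H2' j2' (j2' (W2 (U ?u))) = inv_into H2' j2' (j2' (U' y))" by simp
    then show ?thesis
      using i2'(2) unitary_opD(3) [OF W2 Uu] unitary_opD(3) [OF D'.unU y] k2(5) [OF y] by simp
  qed
  moreover have "W1 (A (adj H1 W1 y)) = A' y" if y: "y \<in> H1'" for y
  proof -
    \<comment> \<open>\<open>B\<close> is the transported \<open>A\<close>. Both \<open>B\<close>
      and \<open>A'\<close> are positive roots of the form <X e, X f> read on \<open>H1'\<close>, so
      they coincide.\<close>
    define B where "B y = W1 (A (inv_into H1 W1 y))" for y
    have bB: "bounded_op H1' H1' B"
      unfolding B_def
      using bounded_op_compose [OF bounded_op_compose [OF unitary_opD(1) [OF k1(1)] D.bA] unitary_opD(1) [OF W1]] .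
    have Ai: "A (inv_into H1 W1 z) \<in> H1" if "z \<in> H1'" for z
      using bounded_opD(1) [OF D.bA k1(4) [OF that]] .
    have "B y = A' y"
    proof (rule positive_sqrt_unique [OF D'.H1 _ D'.posA _ y])
      show "positive_op H1' B"
        unfolding positive_op_def
      proof (intro conjI bB ballI)
        fix z assume z: "z \<in> H1'"
        have "cinner (B z) z = cinner (A (inv_into H1 W1 z)) (inv_into H1 W1 z)"
          using unitary_opD(4) [OF W1 Ai [OF z] k1(4) [OF z]] k1(3) [OF z] by (simp add: B_def)
        then show "cinner (B z) z \<in> \<real>\<^sub>\<ge>\<^sub>0"
          using D.posA k1(4) [OF z] by (simp add: positive_op_def)
      qed
      fix x z assume x: "x \<in> H1'" and z: "z \<in> H1'"
      let ?x = "inv_into H1 W1 x" and ?z = "inv_into H1 W1 z"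
      have "cinner (B x) (B z) = cinner (A ?x) (A ?z)"
        using unitary_opD(4) [OF W1 Ai [OF x] Ai [OF z]] by (simp add: B_def)
      also have "\<dots> = cinner (X (j1 ?x)) (X (j1 ?z))"
        using D.cinner_X_initial [OF k1(4) [OF x] k1(4) [OF z]] by (simp add: j1_def)
      also have "\<dots> = cinner (X (j1' x)) (X (j1' z))"
        using j1W [OF k1(4) [OF x]] j1W [OF k1(4) [OF z]] k1(3) x z by simp
      also have "\<dots> = cinner (A' x) (A' z)"
        using D'.cinner_X_initial [OF x z] by (simp add: j1'_def)
      finally show "cinner (B x) (B z) = cinner (A' x) (A' z)" .
    qed
    then show ?thesis using k1(5) [OF y] by (simp add: B_def)
  qed
  ultimately show ?thesis using W1 W2 W3 by blast
qed

section \<open>Existence\<close>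

text \<open>\<open>C\<close> collects the adjoints of the \<open>J n\<close>, and Bessel's
  inequality puts its values into the sequence space. Surjectivity comes by duality: the adjoint
  \<open>C'\<close> of \<open>C\<close> satisfies C (C' \<xi>) = \<xi> and plays the role of the
  series of the J n applied to the entries of \<xi>.\<close>

lemma unitary_from_orthogonal_isometries:
  fixes H :: "'a::chilbert_space set" and H1 :: "'b::chilbert_space set"
    and J :: "nat \<Rightarrow> 'b \<Rightarrow> 'a"
  assumes H: "hilbert_space H" and H1: "hilbert_space H1" and H3: "hilbert_space H3"
    and sub: "H3 \<subseteq> H" and bJ: "\<And>n. bounded_op H1 H (J n)"
    and JJ: "\<And>m n e f. e \<in> H1 \<Longrightarrow> f \<in> H1 \<Longrightarrow>
      cinner (J m e) (J n f) = (if m = n then cinner e f else 0)"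
    and J3: "\<And>n e h. e \<in> H1 \<Longrightarrow> h \<in> H3 \<Longrightarrow> cinner (J n e) h = 0"
    and H2_def: "H2 = orth H ((\<Union>n. J n ` H1) \<union> H3)"
  shows "\<exists>C. (\<forall>x\<in>H. \<forall>n. l2_nth (C x) n = adj H1 (J n) x) \<and>
    unitary_op H (l2_space H1 \<times> H2 \<times> H3) (\<lambda>x. (C x, adj H2 (\<lambda>x. x) x, adj H3 (\<lambda>x. x) x))"
proof -
  note hs = hilbert_spaceD [OF H] and h1 = hilbert_spaceD [OF H1]
  have hH2: "hilbert_space H2" unfolding H2_def by (rule hilbert_space_orth [OF H])
  have H2H: "x \<in> H" if "x \<in> H2" for x using that by (simp add: H2_def orth_iff)
  have H2J: "cinner (J n e) x = 0" if "x \<in> H2" "e \<in> H1" for x n e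
    using that by (auto simp: H2_def orth_iff cinner_eq_zero_swap [of "J n e"])
  have H23: "cinner x h = 0" if "x \<in> H2" "h \<in> H3" for x h
    using that by (simp add: H2_def orth_iff)
  have H32: "cinner h x = 0" if "x \<in> H2" "h \<in> H3" for x h
    using H23 [OF that] by (simp add: cinner_eq_zero_swap [of h])
  have H3H: "h \<in> H" if "h \<in> H3" for h using sub that by blast
  have J_in: "J n e \<in> H" if "e \<in> H1" for n e using bounded_opD(1) [OF bJ that] .
  have bi2: "bounded_op H2 H (\<lambda>x. x)" and bi3: "bounded_op H3 H (\<lambda>x. x)"
    using H2H H3H by (auto intro!: bounded_op_id)
  define a where "a n x = adj H1 (J n) x" for n x
  have a_in: "a n x \<in> H1" and a: "e \<in> H1 \<Longrightarrow> cinner e (a n x) = cinner (J n e) x" for n x e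
    unfolding a_def by (rule adj_in [OF H1 bJ], rule cinner_adj [OF H1 bJ])
  have aI: "a n x = f" if "f \<in> H1" "\<And>e. e \<in> H1 \<Longrightarrow> cinner e f = cinner (J n e) x" for n x f
    unfolding a_def by (rule adj_eqI [OF H1 bJ that])
  have bessel: "(\<Sum>n<k. (norm (a n x))\<^sup>2) \<le> (norm x)\<^sup>2" for x k
  proof -
    define s where "s = (\<Sum>n<k. J n (a n x))"
    have "inner (J n (a n x)) s = (norm (a n x))\<^sup>2" if "n < k" for n
    proof -
      have "inner (J n (a n x)) s = (\<Sum>m<k. if n = m then (norm (a n x))\<^sup>2 else 0)"
        unfolding s_def inner_sum_right
        by (intro sum.cong refl) (auto simp: inner_cinner JJ a_in cinner_self)
      then show ?thesis using that by simp
    qed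
    then have ss: "inner s s = (\<Sum>n<k. (norm (a n x))\<^sup>2)"
      by (subst (1) s_def) (simp add: inner_sum_left)
    have "inner s x = (\<Sum>n<k. (norm (a n x))\<^sup>2)"
      unfolding s_def inner_sum_left
      by (intro sum.cong refl) (simp add: inner_cinner a_in cinner_self flip: a)
    moreover have "inner (x - s) (x - s) = (norm x)\<^sup>2 - 2 * inner s x + inner s s"
      unfolding power2_norm_eq_inner by (simp only: inner_diff inner_commute [of x s])
    ultimately show ?thesis using ss inner_ge_zero [of "x - s"] by linarith
  qed
  have summ: "summable (\<lambda>n. (norm (a n x))\<^sup>2)" for x
    by (rule bounded_imp_summable [where B = "(norm x)\<^sup>2"])
      (use bessel [of x "Suc _"] in \<open>auto simp: lessThan_Suc_atMost\<close>)
  define C where "C x = Abs_l2seq (\<lambda>n. a n x)" for x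
  have C_nth: "l2_nth (C x) n = a n x" for x n
    by (simp add: C_def Abs_l2seq_inverse summ)
  have ba: "bounded_op H H1 (a n)" for n
    using bounded_op_adj [OF H1 bJ] by (simp add: a_def [abs_def])
  have C_in: "C x \<in> l2_space H1" for x by (simp add: l2_space_def C_nth a_in)
  have bC: "bounded_op H (l2_space H1) C"
  proof (rule bounded_opI [OF C_in])
    show "C (x + y) = C x + C y" if "x \<in> H" "y \<in> H" for x y
      by (rule l2_eqI) (simp add: C_nth plus_l2seq.rep_eq bounded_opD(2) [OF ba that])
    show "C (c *\<^sub>C x) = c *\<^sub>C C x" if "x \<in> H" for c x
      by (rule l2_eqI) (simp add: C_nth scaleC_l2seq.rep_eq bounded_opD(3) [OF ba that])
    show "norm (C x) \<le> 1 * norm x" for x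
    proof -
      have "(norm (C x))\<^sup>2 \<le> (norm x)\<^sup>2"
        unfolding norm_l2seq_sq C_nth by (rule suminf_le_const [OF summ bessel])
      then show ?thesis by (simp add: power2_le_iff_abs_le)
    qed
  qed
  define C' where "C' = adj H C"
  have C'_in: "C' \<xi> \<in> H" and C': "x \<in> H \<Longrightarrow> cinner x (C' \<xi>) = cinner (C x) \<xi>" for \<xi> x
    unfolding C'_def by (rule adj_in [OF H bC], rule cinner_adj [OF H bC])
  have CJ: "C (J m e) = l2_single m e" if e: "e \<in> H1" for m e
  proof (rule l2_eqI)
    have "a n (J m e) = (if n = m then e else 0)" for n
      by (rule aI) (auto simp: e h1 JJ)
    then show "l2_nth (C (J m e)) n = l2_nth (l2_single m e) n" for n
      by (simp add: C_nth l2_single.rep_eq)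
  qed
  have CC': "C (C' \<xi>) = \<xi>" if \<xi>: "\<xi> \<in> l2_space H1" for \<xi>
  proof (rule l2_eqI)
    fix n
    show "l2_nth (C (C' \<xi>)) n = l2_nth \<xi> n"
      unfolding C_nth
    proof (rule aI)
      show "l2_nth \<xi> n \<in> H1" using \<xi> by (simp add: l2_space_def)
      show "cinner e (l2_nth \<xi> n) = cinner (J n e) (C' \<xi>)" if "e \<in> H1" for e
        using that by (simp add: C' J_in CJ cinner_l2_single)
    qed
  qed
  have C3: "C h = 0" if h: "h \<in> H3" for h
  proof (rule l2_eqI)
    have "a n h = 0" for n by (rule aI) (simp_all add: h1 J3 h)
    then show "l2_nth (C h) n = l2_nth 0 n" for n by (simp add: C_nth zero_l2seq.rep_eq)
  qed
  have C2: "C u = 0" if u: "u \<in> H2" for u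
  proof (rule l2_eqI)
    have "a n u = 0" for n by (rule aI) (simp_all add: h1 H2J u)
    then show "l2_nth (C u) n = l2_nth 0 n" for n by (simp add: C_nth zero_l2seq.rep_eq)
  qed
  \<comment> \<open>The adjoint of the inclusion of a closed subspace is the orthogonal projection
    onto it.\<close>
  define P2 where "P2 = adj H2 (\<lambda>x. x :: 'a)"
  define P3 where "P3 = adj H3 (\<lambda>x. x :: 'a)"
  have P2_in: "P2 x \<in> H2" and P2: "u \<in> H2 \<Longrightarrow> cinner u (P2 x) = cinner u x"
    and P2_left: "u \<in> H2 \<Longrightarrow> cinner (P2 x) u = cinner x u" for x u
    unfolding P2_def
    by (rule adj_in [OF hH2 bi2], erule cinner_adj [OF hH2 bi2], erule cinner_adj_left [OF hH2 bi2])
  have P3_in: "P3 x \<in> H3" and P3: "u \<in> H3 \<Longrightarrow> cinner u (P3 x) = cinner u x"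
    and P3_left: "u \<in> H3 \<Longrightarrow> cinner (P3 x) u = cinner x u" for x u
    unfolding P3_def
    by (rule adj_in [OF H3 bi3], erule cinner_adj [OF H3 bi3], erule cinner_adj_left [OF H3 bi3])
  have P2I: "P2 x = u" if "u \<in> H2" "\<And>v. v \<in> H2 \<Longrightarrow> cinner v u = cinner v x" for x u
    unfolding P2_def by (rule adj_eqI [OF hH2 bi2 that])
  have P3I: "P3 x = u" if "u \<in> H3" "\<And>v. v \<in> H3 \<Longrightarrow> cinner v u = cinner v x" for x u
    unfolding P3_def by (rule adj_eqI [OF H3 bi3 that])
  have split: "x = C' (C x) + P2 x + P3 x" if x: "x \<in> H" for x
  proof -
    \<comment> \<open>What remains after removing the copies of \<open>H1\<close> and the kernel
      part is orthogonal to both, so it lies in \<open>H2\<close> and must be the projection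
      \<open>P2 x\<close>.\<close>
    define q where "q = x - C' (C x) - P3 x"
    have qH: "q \<in> H" by (simp add: q_def hs x C'_in H3H P3_in)
    have q2: "q \<in> H2"
      unfolding H2_def orth_iff
    proof (intro conjI ballI qH)
      fix y assume "y \<in> (\<Union>n. J n ` H1) \<union> H3"
      then consider n e where "e \<in> H1" "y = J n e" | "y \<in> H3" by auto
      then have "cinner y q = 0"
      proof cases
        case 1
        then show ?thesis
          by (simp add: q_def cinner_distribs C' J_in CJ cinner_l2_single C_nth a J3 P3_in)
      next
        case 2
        then show ?thesis
          by (simp add: q_def cinner_distribs C' C3 H3H P3)
      qed
      then show "cinner q y = 0" by (simp add: cinner_eq_zero_swap [of q])
    qed
    have "P2 x = q"
      by (rule P2I [OF q2]) (simp add: q_def cinner_distribs C' C2 H2H H23 P3_in)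
    then show ?thesis by (simp add: q_def)
  qed
  have "unitary_op H (l2_space H1 \<times> H2 \<times> H3) (\<lambda>x. (C x, P2 x, P3 x))"
  proof (rule unitary_opI)
    show "(C x, P2 x, P3 x) \<in> l2_space H1 \<times> H2 \<times> H3" for x
      by (simp add: C_in P2_in P3_in)
    have b2: "bounded_op H H2 P2" and b3: "bounded_op H H3 P3"
      unfolding P2_def P3_def by (rule bounded_op_adj [OF hH2 bi2], rule bounded_op_adj [OF H3 bi3])
    show "(C (x + y), P2 (x + y), P3 (x + y)) = (C x, P2 x, P3 x) + (C y, P2 y, P3 y)"
      if "x \<in> H" "y \<in> H" for x y
      by (simp add: bounded_opD(2) [OF bC that] bounded_opD(2) [OF b2 that] bounded_opD(2) [OF b3 that])
    show "(C (c *\<^sub>C x), P2 (c *\<^sub>C x), P3 (c *\<^sub>C x)) = c *\<^sub>C (C x, P2 x, P3 x)" if "x \<in> H" for c x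
      by (simp add: bounded_opD(3) [OF bC that] bounded_opD(3) [OF b2 that]
          bounded_opD(3) [OF b3 that] scaleC_prod_def)
    show "cinner (C x, P2 x, P3 x) (C y, P2 y, P3 y) = cinner x y" if "x \<in> H" "y \<in> H" for x y
    proof -
      have "cinner x y = cinner x (C' (C y)) + cinner x (P2 y) + cinner x (P3 y)"
        by (subst split [OF that(2)]) (simp add: cinner_add_right)
      then show ?thesis
        using that by (simp add: cinner_prod_def C' P2_left P3_left P2_in P3_in)
    qed
    show "\<exists>x\<in>H. (C x, P2 x, P3 x) = y" if y_in: "y \<in> l2_space H1 \<times> H2 \<times> H3" for y
    proof -
      obtain \<xi> u h where y: "y = (\<xi>, u, h)" and \<xi>: "\<xi> \<in> l2_space H1" and u: "u \<in> H2" and h: "h \<in> H3"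
        using y_in by auto
      define x where "x = C' \<xi> + u + h"
      have xH: "x \<in> H" by (simp add: x_def hs C'_in H2H H3H u h)
      have "C x = \<xi>"
        by (simp add: x_def bounded_opD(2) [OF bC] hs C'_in H2H H3H u h CC' \<xi> C2 C3)
      moreover have "P2 x = u"
        by (rule P2I [OF u]) (simp add: x_def cinner_distribs C' H2H C2 H23 h)
      moreover have "P3 x = h"
        by (rule P3I [OF h]) (simp add: x_def cinner_distribs C' H3H C3 H32 u)
      ultimately show ?thesis using xH y by blast
    qed
  qed
  then show ?thesis
    unfolding P2_def P3_def by (intro exI [of _ C]) (simp add: C_nth a_def)
qed

section \<open>The range of X, its complement and the wandering subspace\<close>

locale scaling_relation =
  fixes H :: "'a::chilbert_space set" and X :: "'a \<Rightarrow> 'a"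
  assumes H: "hilbert_space H" and bX: "bounded_op H H X"
    and rel: "\<And>x. x \<in> H \<Longrightarrow> adj H X (X (X x)) = X x"
begin

text \<open>These three are the spaces N, R and E: \<open>ran\<close> is the closure of the range,
  as a double complement, and \<open>wander\<close> is the part of \<open>ran\<close> orthogonal to
  X ran.\<close>

definition coker where "coker = orth H (X ` H)"
definition ran where "ran = orth H coker"
definition wander where "wander = orth H (coker \<union> X ` ran)"

abbreviation "H1 \<equiv> op_initial H X"
abbreviation "H3 \<equiv> op_ker H X"

lemmas hs = hilbert_spaceD [OF H]

lemma X_in: "x \<in> H \<Longrightarrow> X x \<in> H"
  by (rule bounded_opD(1) [OF bX])

lemma hcoker: "hilbert_space coker" and hran: "hilbert_space ran" and hwander: "hilbert_space wander"
  and hH1: "hilbert_space H1"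
  unfolding coker_def ran_def wander_def op_initial_def by (rule hilbert_space_orth [OF H])+

lemma cinner_XXX: "x \<in> H \<Longrightarrow> z \<in> H \<Longrightarrow> cinner (X z) (X (X x)) = cinner z (X x)"
  using cinner_adj [OF H bX, of z "X (X x)"] rel by simp

lemma cokerD: "x \<in> coker \<Longrightarrow> x \<in> H" "x \<in> coker \<Longrightarrow> z \<in> H \<Longrightarrow> cinner x (X z) = 0"
  by (auto simp: coker_def orth_iff)

lemma ranD: "x \<in> ran \<Longrightarrow> x \<in> H" "x \<in> ran \<Longrightarrow> n \<in> coker \<Longrightarrow> cinner x n = 0"
  by (auto simp: ran_def orth_iff)

lemma wanderD: "x \<in> wander \<Longrightarrow> x \<in> H" "x \<in> wander \<Longrightarrow> n \<in> coker \<Longrightarrow> cinner x n = 0"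
  "x \<in> wander \<Longrightarrow> r \<in> ran \<Longrightarrow> cinner x (X r) = 0"
  by (auto simp: wander_def orth_iff)

lemma wander_ran: "x \<in> wander \<Longrightarrow> x \<in> ran"
  by (simp add: ran_def orth_iff wanderD)

lemma H1D: "x \<in> H1 \<Longrightarrow> x \<in> H" "x \<in> H1 \<Longrightarrow> x \<in> coker" "x \<in> H1 \<Longrightarrow> k \<in> H3 \<Longrightarrow> cinner x k = 0"
  by (auto simp: op_initial_def coker_def orth_iff)

lemma H3D: "x \<in> H3 \<Longrightarrow> x \<in> H" "x \<in> H3 \<Longrightarrow> X x = 0"
  by (auto simp: op_ker_def)

text \<open>On the kernel X*X is 0 and on the range it is the identity; eigenvectors of a symmetric
  operator for different eigenvalues are orthogonal.\<close>

lemma ker_coker: "x \<in> H3 \<Longrightarrow> x \<in> coker"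
  using cinner_XXX [of _ x] by (auto simp: coker_def orth_iff op_ker_def)

lemma X_ran: "x \<in> H \<Longrightarrow> X x \<in> ran"
  using cokerD(2) by (simp add: ran_def orth_iff X_in cinner_eq_zero_swap [of "X x"])

text \<open>This is the relation read through adjoints: (X*X - 1) X = 0 becomes X* (X*X - 1) = 0,
  and \<open>coker\<close> is the kernel of the adjoint.\<close>

lemma defect_coker:
  assumes "x \<in> H"
  shows "adj H X (X x) - x \<in> coker"
  unfolding coker_def orth_iff
  using assms cinner_XXX
  by (auto simp: hs adj_in [OF H bX] cinner_diff_left cinner_adj_left [OF H bX] X_in)

text \<open>Extends the relation from the range to its closure without limits. The defect d lies in
  \<open>coker\<close>, and so does X*X d; both are orthogonal to r, and moving X*X across the inner
  product gives <d, d> = 0.\<close>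

lemma adj_X_ran:
  assumes r: "r \<in> ran"
  shows "adj H X (X r) = r"
proof -
  define d where "d = adj H X (X r) - r"
  have d: "d \<in> coker" unfolding d_def by (rule defect_coker [OF ranD(1) [OF r]])
  have "adj H X (X d) - d + d \<in> coker"
    by (rule hilbert_spaceD(2) [OF hcoker defect_coker [OF cokerD(1) [OF d]] d])
  then have "cinner r (adj H X (X d)) = 0" using ranD(2) [OF r] by simp
  then have "cinner (adj H X (X r)) d = 0"
    by (simp add: cinner_adj [OF H bX] cinner_adj_left [OF H bX] ranD(1) [OF r] cokerD(1) [OF d])
  then have "cinner d d = 0"
    using ranD(2) [OF r d] by (subst (1) d_def) (simp add: cinner_diff_left)
  then show ?thesis by (simp add: d_def)
qed

text \<open>Only one argument has to lie in \<open>ran\<close>. This is stronger than isometry on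
  \<open>ran\<close>: it also makes X ran orthogonal to the image of \<open>coker\<close>.\<close>

lemma cinner_X_ran: "r \<in> ran \<Longrightarrow> z \<in> H \<Longrightarrow> cinner (X r) (X z) = cinner r z"
  using cinner_adj_left [OF H bX, of z "X r"] by (simp add: adj_X_ran)

text \<open>Closedness of the kernel is obtained by writing it as the orthogonal complement of the
  range of the adjoint.\<close>

lemma hH3: "hilbert_space H3"
proof -
  have "H3 = orth H (adj H X ` H)"
  proof (intro set_eqI iffI)
    fix x assume "x \<in> H3"
    then show "x \<in> orth H (adj H X ` H)"
      by (auto simp: orth_iff op_ker_def cinner_adj [OF H bX])
  next
    fix x assume x: "x \<in> orth H (adj H X ` H)"
    then have xH: "x \<in> H" and "cinner x (adj H X (X x)) = 0" using X_in by (auto simp: orth_iff)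
    then have "X x = 0" by (simp add: cinner_adj [OF H bX])
    then show "x \<in> H3" using xH by (simp add: op_ker_def)
  qed
  then show ?thesis using hilbert_space_orth [OF H] by simp
qed

text \<open>Project onto the kernel; since the kernel lies in \<open>coker\<close>, the remainder
  stays in \<open>coker\<close> and so is orthogonal to range and kernel.\<close>

lemma coker_split:
  assumes n: "n \<in> coker"
  obtains e h where "n = e + h" "e \<in> H1" "h \<in> H3"
proof
  have b: "bounded_op H3 H (\<lambda>x. x)" using H3D by (auto intro!: bounded_op_id)
  let ?h = "adj H3 (\<lambda>x. x) n"
  show h: "?h \<in> H3" by (rule adj_in [OF hH3 b])
  have c: "n - ?h \<in> coker" by (rule hilbert_spaceD(3) [OF hcoker n ker_coker [OF h]])
  show "n - ?h \<in> H1"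
    unfolding op_initial_def orth_iff
  proof (intro conjI ballI cokerD(1) [OF c])
    fix y assume "y \<in> X ` H \<union> H3"
    then consider z where "z \<in> H" "y = X z" | "y \<in> H3" by auto
    then show "cinner (n - ?h) y = 0"
    proof cases
      case 1
      then show ?thesis using cokerD(2) [OF c] by simp
    next
      case 2
      then show ?thesis by (simp add: cinner_diff_left cinner_adj_left [OF hH3 b])
    qed
  qed
qed simp

lemma space_split:
  assumes x: "x \<in> H"
  obtains r e h where "x = r + e + h" "r \<in> ran" "e \<in> H1" "h \<in> H3"
proof -
  have b: "bounded_op coker H (\<lambda>x. x)" using cokerD(1) by (auto intro!: bounded_op_id)
  define n where "n = adj coker (\<lambda>x. x) x"
  have n: "n \<in> coker" unfolding n_def by (rule adj_in [OF hcoker b])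
  have r: "x - n \<in> ran"
    by (auto simp: ran_def orth_iff hs x cokerD(1) n cinner_diff_left)
      (simp add: n_def cinner_adj_left [OF hcoker b])
  obtain e h where eh: "n = e + h" "e \<in> H1" "h \<in> H3" using coker_split [OF n] .
  have "x = x - n + e + h" using eh(1) by simp
  then show thesis using that r eh(2,3) by blast
qed

lemma X_H1: "e \<in> H1 \<Longrightarrow> X e \<in> wander"
  unfolding wander_def orth_iff
proof (intro conjI ballI)
  assume e: "e \<in> H1"
  show "X e \<in> H" by (rule X_in [OF H1D(1) [OF e]])
  fix y assume "y \<in> coker \<union> X ` ran"
  then consider "y \<in> coker" | r where "r \<in> ran" "y = X r" by auto
  then show "cinner (X e) y = 0"
  proof cases
    case 1
    then show ?thesis using ranD(2) [OF X_ran [OF H1D(1) [OF e]]] by simp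
  next
    case 2
    then show ?thesis
      using cinner_X_ran [OF 2(1) H1D(1) [OF e]] ranD(2) [OF 2(1) H1D(2) [OF e]]
      by (simp add: cinner_eq_zero_swap [of "X e"])
  qed
qed

text \<open>The range of \<open>X\<close> is X ran + X H1. A vector of \<open>wander\<close>
  orthogonal to X H1 is thus orthogonal to the whole range, so it lies in \<open>coker\<close>, to
  which \<open>wander\<close> is orthogonal.\<close>

lemma X_H1_dense:
  assumes w: "w \<in> wander" and orth: "\<And>e. e \<in> H1 \<Longrightarrow> cinner (X e) w = 0"
  shows "w = 0"
proof -
  have "cinner w (X z) = 0" if z: "z \<in> H" for z
  proof -
    obtain r e h where s: "z = r + e + h" "r \<in> ran" "e \<in> H1" "h \<in> H3" using space_split [OF z] .
    have "X z = X r + X e"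
      using s by (simp add: bounded_opD(2) [OF bX] hs ranD(1) H1D(1) H3D)
    then show ?thesis
      using wanderD(3) [OF w s(2)] orth [OF s(3), THEN cinner_eq_zero_swap [THEN iffD1]]
      by (simp add: cinner_add_right)
  qed
  then have "w \<in> coker" using wanderD(1) [OF w] by (auto simp: coker_def orth_iff)
  from wanderD(2) [OF w this] show ?thesis by simp
qed

text \<open>\<open>A\<close> is the root of the form <X e, X f> on \<open>H1\<close>, injective
  because \<open>H1\<close> is orthogonal to the kernel of \<open>X\<close>. As \<open>A\<close> is
  dense in \<open>H1\<close> and \<open>X\<close> in \<open>wander\<close>, sending A e to X e
  extends to a unitary.\<close>

lemma polar_decomposition:
  "\<exists>A V. positive_op H1 A \<and> (\<forall>e\<in>H1. A e = 0 \<longrightarrow> e = 0) \<and> unitary_op H1 wander V \<and>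
    (\<forall>e\<in>H1. V (A e) = X e)"
proof -
  have b: "bounded_op H1 H X"
    by (rule bounded_op_subset [OF bX]) (auto dest: H1D(1) X_in)
  obtain A where A: "positive_op H1 A"
    and AX: "\<And>e f. e \<in> H1 \<Longrightarrow> f \<in> H1 \<Longrightarrow> cinner (A e) (A f) = cinner (X e) (X f)"
    using positive_sqrt_exists [OF hH1 b] by blast
  have inj: "e = 0" if e: "e \<in> H1" "A e = 0" for e
  proof -
    have "X e = 0" using AX [OF e(1) e(1)] e(2) by simp
    then have "e \<in> H3" using H1D(1) [OF e(1)] by (simp add: op_ker_def)
    from H1D(3) [OF e(1) this] show ?thesis by simp
  qed
  have bA: "bounded_op H1 H1 A" using A by (simp add: positive_op_def)
  have "\<exists>V. unitary_op H1 wander V \<and> (\<forall>e\<in>H1. V (A e) = X e)"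
    by (rule unitary_from_dense_ranges [OF hH1 hwander bounded_opD(1) [OF bA] X_H1 AX
          positive_op_dense_range [OF hH1 A inj] X_H1_dense])
  then show ?thesis using A inj by blast
qed

end

section \<open>The orthogonal copies of H1 and the unitary summand\<close>

locale polar_data = scaling_relation +
  fixes A V
  assumes A: "positive_op H1 A" and V: "unitary_op H1 wander V"
    and VA: "\<And>e. e \<in> H1 \<Longrightarrow> V (A e) = X e"
    and inj: "\<And>e. e \<in> H1 \<Longrightarrow> A e = 0 \<Longrightarrow> e = 0"
begin

lemma bA: "bounded_op H1 H1 A"
  using A by (simp add: positive_op_def)

lemma V_in: "e \<in> H1 \<Longrightarrow> V e \<in> wander"
  by (rule unitary_opD(3) [OF V])

text \<open>\<open>V\<close> enters at index 1 so that X J_0 = J_1 A, which is X = V A on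
  \<open>H1\<close>, while X J_n = J_(n+1) for n >= 1: exactly the action of the weighted
  shift.\<close>

definition J :: "nat \<Rightarrow> 'a \<Rightarrow> 'a"
  where "J n e = (case n of 0 \<Rightarrow> e | Suc m \<Rightarrow> (X ^^ m) (V e))"

lemma J_simps: "J 0 e = e" "J (Suc 0) e = V e" "J (Suc (Suc n)) e = X (J (Suc n) e)"
  by (simp_all add: J_def)

lemma J_Suc_ran: "e \<in> H1 \<Longrightarrow> J (Suc n) e \<in> ran"
proof (induction n)
  case 0
  then show ?case by (simp add: J_simps wander_ran V_in)
next
  case (Suc n)
  then show ?case using X_ran [OF ranD(1)] by (simp add: J_simps(3))
qed

lemma bJ: "bounded_op H1 H (J n)"
proof (cases n)
  case 0
  have "H1 \<subseteq> H" using H1D(1) by blast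
  from bounded_op_id [OF this] show ?thesis by (simp add: 0 J_def [abs_def])
next
  case (Suc m)
  have "bounded_op H1 H V"
    by (rule bounded_op_subset [OF unitary_opD(1) [OF V]]) (auto dest: V_in wanderD(1))
  from bounded_op_compose [OF this bounded_op_funpow [OF bX]]
  show ?thesis by (simp add: Suc J_def [abs_def])
qed

text \<open>Strip \<open>X\<close> from both sides, which is isometric on \<open>ran\<close>, until
  one index is minimal; what remains pairs a vector of \<open>wander\<close> with X ran, or two
  values of \<open>V\<close>.\<close>

lemma cinner_J_Suc:
  assumes "e \<in> H1" "f \<in> H1"
  shows "cinner (J (Suc m) e) (J (Suc n) f) = (if m = n then cinner e f else 0)"
proof (induction m arbitrary: n)
  case 0
  show ?case
  proof (cases n)
    case 0
    then show ?thesis using unitary_opD(4) [OF V assms] by (simp add: J_simps)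
  next
    case (Suc k)
    then show ?thesis
      using wanderD(3) [OF V_in [OF assms(1)] J_Suc_ran [OF assms(2)]] by (simp add: J_simps)
  qed
next
  case (Suc m)
  show ?case
  proof (cases n)
    case 0
    then show ?thesis
      using wanderD(3) [OF V_in [OF assms(2)] J_Suc_ran [OF assms(1)], of m]
      by (simp add: J_simps cinner_eq_zero_swap [of "X _"])
  next
    case (Suc k)
    then show ?thesis
      using cinner_X_ran [OF J_Suc_ran [OF assms(1)] ranD(1) [OF J_Suc_ran [OF assms(2)]], of m k]
        Suc.IH [of k] by (simp add: J_simps(3))
  qed
qed

lemma cinner_J:
  assumes "e \<in> H1" "f \<in> H1"
  shows "cinner (J m e) (J n f) = (if m = n then cinner e f else 0)"
proof -
  have 0: "cinner (J (Suc m) e) f = 0" if "e \<in> H1" "f \<in> H1" for m e f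
    using ranD(2) [OF J_Suc_ran [OF that(1)] H1D(2) [OF that(2)]] .
  show ?thesis
  proof (cases m)
    case m: 0
    show ?thesis
      using 0 [OF assms(2,1)] by (cases n) (simp_all add: m J_simps(1) cinner_eq_zero_swap [of e])
  next
    case m: (Suc k)
    show ?thesis
      using 0 [OF assms] cinner_J_Suc [OF assms] by (cases n) (simp_all add: m J_simps(1))
  qed
qed

lemma cinner_J_ker:
  assumes "e \<in> H1" "h \<in> H3"
  shows "cinner (J n e) h = 0"
proof (cases n)
  case 0
  then show ?thesis using H1D(3) [OF assms] by (simp add: J_simps)
next
  case (Suc m)
  then show ?thesis using ranD(2) [OF J_Suc_ran [OF assms(1)] ker_coker [OF assms(2)]] by simp
qed

definition H2 where "H2 = orth H ((\<Union>n. J n ` H1) \<union> H3)"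

lemma hH2: "hilbert_space H2"
  unfolding H2_def by (rule hilbert_space_orth [OF H])

lemma H2D: "x \<in> H2 \<Longrightarrow> x \<in> H" "x \<in> H2 \<Longrightarrow> e \<in> H1 \<Longrightarrow> cinner x (J n e) = 0"
  "x \<in> H2 \<Longrightarrow> h \<in> H3 \<Longrightarrow> cinner x h = 0"
  by (auto simp: H2_def orth_iff)

text \<open>Membership in \<open>ran\<close> already gives orthogonality to the zeroth copy and to
  the kernel, both of which lie in \<open>coker\<close>.\<close>

lemma H2I:
  assumes "x \<in> ran" and S: "\<And>n e. e \<in> H1 \<Longrightarrow> cinner x (J (Suc n) e) = 0"
  shows "x \<in> H2"
  unfolding H2_def orth_iff
proof (intro conjI ballI)
  show "x \<in> H" by (rule ranD(1) [OF assms(1)])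
  fix y assume "y \<in> (\<Union>n. J n ` H1) \<union> H3"
  then consider n e where "e \<in> H1" "y = J n e" | "y \<in> H3" by auto
  then show "cinner x y = 0"
  proof cases
    case 1
    then show ?thesis
      using S ranD(2) [OF assms(1) H1D(2) [OF 1(1)]] by (cases n) (simp_all add: J_simps(1))
  next
    case 2
    then show ?thesis using ranD(2) [OF assms(1) ker_coker] by simp
  qed
qed

lemma H2_ran:
  assumes x: "x \<in> H2"
  shows "x \<in> ran"
  unfolding ran_def orth_iff
proof (intro conjI ballI H2D(1) [OF x])
  fix n assume "n \<in> coker"
  then obtain e h where "n = e + h" "e \<in> H1" "h \<in> H3" by (rule coker_split)
  then show "cinner x n = 0"
    using H2D(2) [OF x, of e 0] H2D(3) [OF x] by (simp add: J_simps(1) cinner_add_right)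
qed

text \<open>For surjectivity the preimage of y must be X* y. The error w = y - X X* y lies in
  \<open>wander\<close>, which is the copy of \<open>H1\<close> with index 1 and hence orthogonal to
  y; it is also orthogonal to X ran, so w is orthogonal to itself.\<close>

lemma unitary_X_H2: "unitary_op H2 H2 X"
proof (rule unitary_opI)
  show "X x \<in> H2" if x: "x \<in> H2" for x
  proof (rule H2I [OF X_ran [OF H2D(1) [OF x]]])
    fix n e assume e: "e \<in> H1"
    show "cinner (X x) (J (Suc n) e) = 0"
    proof (cases n)
      case 0
      then show ?thesis
        using wanderD(3) [OF V_in [OF e] H2_ran [OF x]]
        by (simp add: J_simps cinner_eq_zero_swap [of "X x"])
    next
      case (Suc m)
      then show ?thesis
        using cinner_X_ran [OF H2_ran [OF x] ranD(1) [OF J_Suc_ran [OF e]]] H2D(2) [OF x e]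
        by (simp add: J_simps(3))
    qed
  qed
  show "X (x + y) = X x + X y" if "x \<in> H2" "y \<in> H2" for x y
    by (rule bounded_opD(2) [OF bX]) (use that H2D(1) in auto)
  show "X (c *\<^sub>C x) = c *\<^sub>C X x" if "x \<in> H2" for c x
    by (rule bounded_opD(3) [OF bX]) (use that H2D(1) in auto)
  show "cinner (X x) (X y) = cinner x y" if "x \<in> H2" "y \<in> H2" for x y
    by (rule cinner_X_ran [OF H2_ran [OF that(1)] H2D(1) [OF that(2)]])
  show "\<exists>x\<in>H2. X x = y" if y: "y \<in> H2" for y
  proof
    define x where "x = adj H X y"
    have xH: "x \<in> H" unfolding x_def by (rule adj_in [OF H bX])
    have cx: "cinner x z = cinner y (X z)" if "z \<in> H" for z
      unfolding x_def by (rule cinner_adj_left [OF H bX that])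
    have x_ran: "x \<in> ran"
      unfolding ran_def orth_iff
    proof (intro conjI ballI xH)
      fix n assume "n \<in> coker"
      then obtain e h where n: "n = e + h" "e \<in> H1" "h \<in> H3" by (rule coker_split)
      have "cinner y (X e) = 0"
        using H2D(2) [OF y bounded_opD(1) [OF bA n(2)], of "Suc 0"] VA [OF n(2)]
        by (simp add: J_simps(2))
      then show "cinner x n = 0"
        using n by (simp add: cinner_add_right cx H1D(1) H3D)
    qed
    show "x \<in> H2"
    proof (rule H2I [OF x_ran])
      show "cinner x (J (Suc n) e) = 0" if e: "e \<in> H1" for n e
        using H2D(2) [OF y e, of "Suc (Suc n)"]
        by (simp add: cx ranD(1) [OF J_Suc_ran [OF e]] J_simps(3))
    qed
    define w where "w = y - X x"
    have w: "w \<in> wander"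
      unfolding wander_def orth_iff
    proof (intro conjI ballI)
      show wH: "w \<in> H" by (simp add: w_def hs H2D(1) y X_in xH)
      have w_ran: "w \<in> ran"
        unfolding w_def by (rule hilbert_spaceD(3) [OF hran H2_ran [OF y] X_ran [OF xH]])
      fix v assume "v \<in> coker \<union> X ` ran"
      then consider "v \<in> coker" | r where "r \<in> ran" "v = X r" by auto
      then show "cinner w v = 0"
      proof cases
        case 1
        then show ?thesis by (rule ranD(2) [OF w_ran])
      next
        case 2
        then show ?thesis
          using cinner_X_ran [OF x_ran ranD(1) [OF 2(1)]] cx [OF ranD(1) [OF 2(1)]]
          by (simp add: w_def cinner_diff_left)
      qed
    qed
    then have "w \<in> V ` H1" using unitary_opD(2) [OF V] by simp
    then obtain e where e: "e \<in> H1" "w = V e" by (rule imageE)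
    have "cinner y w = 0" using H2D(2) [OF y e(1), of "Suc 0"] e(2) by (simp add: J_simps(2))
    moreover have "cinner (X x) w = 0"
      using wanderD(3) [OF w x_ran] by (simp add: cinner_eq_zero_swap [of "X x"])
    ultimately have "cinner w w = 0" by (subst (1) w_def) (simp add: cinner_diff_left)
    then show "X x = y" by (simp add: w_def)
  qed
qed

text \<open>The intertwining relation is checked entry by entry: the adjoint of J_0 kills the range;
  that of J_1 sees only the \<open>H1\<close> component of x, through X = V A; for higher indices
  one factor \<open>X\<close> cancels by isometry on \<open>ran\<close>.\<close>

lemma decomposition: "decomposition H X H1 H2 H3 A X"
proof -
  have b0: "bounded_op H3 H (\<lambda>x. x)" "bounded_op H2 H (\<lambda>x. x)"
    using H3D(1) H2D(1) by (auto intro!: bounded_op_id)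
  have "H3 \<subseteq> H" using H3D(1) by blast
  from unitary_from_orthogonal_isometries [OF H hH1 hH3 this bJ cinner_J cinner_J_ker H2_def]
  obtain C where C: "\<And>x n. x \<in> H \<Longrightarrow> l2_nth (C x) n = adj H1 (J n) x"
    and un: "unitary_op H (l2_space H1 \<times> H2 \<times> H3) (\<lambda>x. (C x, adj H2 (\<lambda>x. x) x, adj H3 (\<lambda>x. x) x))"
    by blast
  have "C (X x) = wshift A (C x)" if x: "x \<in> H" for x
  proof (rule l2_eqI)
    fix n
    consider "n = 0" | "n = Suc 0" | m where "n = Suc (Suc m)" by (metis not0_implies_Suc)
    then show "l2_nth (C (X x)) n = l2_nth (wshift A (C x)) n"
    proof cases
      case 1
      have "adj H1 (J 0) (X x) = 0"
        by (rule adj_eqI [OF hH1 bJ])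
          (simp_all add: hilbert_spaceD(1) [OF hH1] J_simps(1) cokerD(2) [OF H1D(2)] x)
      then show ?thesis using 1 by (simp add: C X_in x)
    next
      case 2
      obtain r e h where s: "x = r + e + h" "r \<in> ran" "e \<in> H1" "h \<in> H3" using space_split [OF x] .
      have "adj H1 (J 0) x = e"
      proof (rule adj_eqI [OF hH1 bJ s(3)])
        show "cinner f e = cinner (J 0 f) x" if f: "f \<in> H1" for f
          using ranD(2) [OF s(2) H1D(2) [OF f]] H1D(3) [OF f s(4)]
          by (simp add: s(1) J_simps(1) cinner_add_right cinner_eq_zero_swap [of f r])
      qed
      moreover have "adj H1 (J (Suc 0)) (X x) = A e"
      proof (rule adj_eqI [OF hH1 bJ bounded_opD(1) [OF bA s(3)]])
        fix f assume f: "f \<in> H1"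
        have "X x = X r + V (A e)"
          using s by (simp add: bounded_opD(2) [OF bX] hs ranD(1) H1D(1) H3D VA)
        then show "cinner f (A e) = cinner (J (Suc 0) f) (X x)"
          using wanderD(3) [OF V_in [OF f] s(2)]
            unitary_opD(4) [OF V f bounded_opD(1) [OF bA s(3)]]
          by (simp add: J_simps(2) cinner_add_right)
      qed
      ultimately show ?thesis using 2 by (simp add: C X_in x)
    next
      case 3
      have "adj H1 (J (Suc (Suc m))) (X x) = adj H1 (J (Suc m)) x"
      proof (rule adj_eqI [OF hH1 bJ adj_in [OF hH1 bJ]])
        show "cinner f (adj H1 (J (Suc m)) x) = cinner (J (Suc (Suc m)) f) (X x)" if f: "f \<in> H1" for f
          using cinner_X_ran [OF J_Suc_ran [OF f] x] by (simp add: cinner_adj [OF hH1 bJ f] J_simps(3))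
      qed
      then show ?thesis using 3 by (simp add: C X_in x)
    qed
  qed
  moreover have "adj H2 (\<lambda>x. x) (X x) = X (adj H2 (\<lambda>x. x) x)" if x: "x \<in> H" for x
  proof (rule adj_eqI [OF hH2 b0(2)])
    have p: "adj H2 (\<lambda>x. x) x \<in> H2" by (rule adj_in [OF hH2 b0(2)])
    show "X (adj H2 (\<lambda>x. x) x) \<in> H2" by (rule unitary_opD(3) [OF unitary_X_H2 p])
    \<comment> \<open>Since \<open>X\<close> maps \<open>H2\<close> onto itself, every test vector
      has the form X v, and \<open>X\<close> can be cancelled on both sides.\<close>
    fix u assume "u \<in> H2"
    then have "u \<in> X ` H2" using unitary_opD(2) [OF unitary_X_H2] by simp
    then obtain v where v: "u = X v" "v \<in> H2" by (rule imageE)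
    show "cinner u (X (adj H2 (\<lambda>x. x) x)) = cinner u (X x)"
      using cinner_X_ran [OF H2_ran [OF v(2)] H2D(1) [OF p]] cinner_X_ran [OF H2_ran [OF v(2)] x]
        cinner_adj [OF hH2 b0(2) v(2), of x] by (simp add: v(1))
  qed
  moreover have "adj H3 (\<lambda>x. x) (X x) = 0" if x: "x \<in> H" for x
    by (rule adj_eqI [OF hH3 b0(1)])
      (simp_all add: hilbert_spaceD(1) [OF hH3] cokerD(2) [OF ker_coker] x)
  ultimately have "\<exists>\<Phi>. unitary_op H (l2_space H1 \<times> H2 \<times> H3) \<Phi> \<and>
      (\<forall>x\<in>H. \<Phi> (X x) = map_prod (wshift A) (map_prod X (\<lambda>_. 0)) (\<Phi> x))"
    by (intro exI [of _ "\<lambda>x. (C x, adj H2 (\<lambda>x. x) x, adj H3 (\<lambda>x. x) x)"] conjI un) simp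
  moreover have "is_support H1 A (\<lambda>x. x)"
    unfolding is_support_id_iff [OF hH1 A] using inj by simp
  ultimately show ?thesis
    unfolding decomposition_def by (intro conjI hH1 hH2 hH3 A unitary_X_H2)
qed

end

lemma (in scaling_relation) decomposition_exists: "\<exists>(H2 :: 'a set) A U. decomposition H X H1 H2 H3 A U"
proof -
  obtain A V where AV: "positive_op H1 A" "\<And>e. e \<in> H1 \<Longrightarrow> A e = 0 \<Longrightarrow> e = 0"
    "unitary_op H1 wander V" "\<And>e. e \<in> H1 \<Longrightarrow> V (A e) = X e"
    using polar_decomposition by blast
  interpret polar_data H X A V
    by (rule polar_data.intro [OF scaling_relation_axioms polar_data_axioms.intro]) (fact AV)+
  show ?thesis using decomposition by blast
qed

text \<open>The summands constructed are subspaces of \<open>H\<close>, so existence takes place in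
  the ambient type of \<open>H\<close>; uniqueness and the criterion concern decompositions in
  arbitrary ambient types.\<close>

theorem theoremA:
  fixes H :: "'a::chilbert_space set" and X :: "'a \<Rightarrow> 'a"
  assumes "hilbert_space H"
    and "bounded_op H H X"
    and "\<forall>x\<in>H. adj H X (X (X x)) = X x"
  shows
    "(\<exists>(H1 :: 'a set) (H2 :: 'a set) (H3 :: 'a set) A U. decomposition H X H1 H2 H3 A U) \<and>
     (\<forall>(H1 :: 'b1::chilbert_space set) (H2 :: 'b2::chilbert_space set)
        (H3 :: 'b3::chilbert_space set) A U
        (H1' :: 'c1::chilbert_space set) (H2' :: 'c2::chilbert_space set)
        (H3' :: 'c3::chilbert_space set) A' U'.
        decomposition H X H1 H2 H3 A U \<and> decomposition H X H1' H2' H3' A' U' \<longrightarrow>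
        (\<exists>W1 W2 W3.
          unitary_op H1 H1' W1 \<and> unitary_op H2 H2' W2 \<and> unitary_op H3 H3' W3 \<and>
          (\<forall>y\<in>H1'. W1 (A (adj H1 W1 y)) = A' y) \<and>
          (\<forall>y\<in>H2'. W2 (U (adj H2 W2 y)) = U' y))) \<and>
     (\<forall>(H1 :: 'b1 set) (H2 :: 'b2 set) (H3 :: 'b3 set) A U.
        decomposition H X H1 H2 H3 A U \<longrightarrow> (scaling_element H X \<longleftrightarrow> H1 \<noteq> {0}))"
proof (intro conjI allI impI)
  interpret scaling_relation H X
    by unfold_locales (use assms in simp_all)
  show "\<exists>(H1 :: 'a set) (H2 :: 'a set) (H3 :: 'a set) A U. decomposition H X H1 H2 H3 A U"
    using decomposition_exists by blast
next
  fix H1 :: "'b1 set" and H2 :: "'b2 set" and H3 :: "'b3 set" and A U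
    and H1' :: "'c1 set" and H2' :: "'c2 set" and H3' :: "'c3 set" and A' U'
  assume "decomposition H X H1 H2 H3 A U \<and> decomposition H X H1' H2' H3' A' U'"
  then show "\<exists>W1 W2 W3.
      unitary_op H1 H1' W1 \<and> unitary_op H2 H2' W2 \<and> unitary_op H3 H3' W3 \<and>
      (\<forall>y\<in>H1'. W1 (A (adj H1 W1 y)) = A' y) \<and> (\<forall>y\<in>H2'. W2 (U (adj H2 W2 y)) = U' y)"
    by (elim conjE) (rule decomposition_unique [OF assms(1,2)])
next
  fix H1 :: "'b1 set" and H2 :: "'b2 set" and H3 :: "'b3 set" and A U
  assume "decomposition H X H1 H2 H3 A U"
  then interpret decomposed H X H1 H2 H3 A U
    using assms by unfold_locales
  show "scaling_element H X \<longleftrightarrow> H1 \<noteq> {0}"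
    by (rule scaling_element_iff [OF assms(3)])
qed

end
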